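(* Let $E$ be a real vector space, $\chi:E\to\mathbb{C}$ a characteristic function with $\chi(0)=1$, and $\mu$ the corresponding measure on $(E^a,\mathcal{B}_E)$. Then the cone $(E^a,\mu,\varphi_R)$ is a realization of the limit in $\mathfrak{M}$ of the convergent diagram $(R^a,\mu_R,\pi_{RF})$ indexed by $\mathcal{R}$. Moreover, for each $1\le p<\infty$, the cocone $(L^p(E^a,\mu),\varphi_R^* )$ is the colimit in $\mathfrak{Ban}$ of the codiagram $(L^p(R^a,\mu_R),\pi_{RF}^* )$.
   Context: $E^a$ is the algebraic dual of $E$ (all linear functionals $E\to\mathbb{R}$). For $\xi\in E$ let $\xi_*:E^a\to\mathbb{R}$, $\xi_*(\ell)=\ell(\xi)$, and $\mathcal{B}_E=\sigma(\{\xi_*^{-1}(B):\xi\in E,\ B\subset\mathbb{R}\text{ Borel}\})$. $\mathcal{R}$ is the set of finite dimensional subspaces of $E$, directed by inclusion (written $R\le F$). A characteristic function is a map $\chi:E\to\mathbb{C}$ such that $\sum_{j,k=1}^n\alpha_j\bar\alpha_k\chi(\xi_j-\xi_k)\ge0$ for all $n\in\mathbb{N}$, $\xi_j\in E$, $\alpha_j\in\mathbb{C}$, and $\chi|_R$ is continuous for the Euclidean topology on each $R\in\mathcal{R}$. By the Bochner–Minlos theorem there is a unique measure $\mu$ on $(E^a,\mathcal{B}_E)$ with $\chi(\xi)=\int_{E^a}e^{i\ell(\xi)}\,\mathrm{d}\mu(\ell)$ for all $\xi\in E$ (the corresponding measure). For $R\in\mathcal{R}$, $\mu_R$ is the Borel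 measure on the finite dimensional space $R^a$ corresponding in the same way to $\chi|_R$. For $R\le F$ in $\mathcal{R}$, $\pi_{RF}:F^a\to R^a$, $\pi_{RF}(\ell)=\ell|_R$; and $\varphi_R:E^a\to R^a$, $\varphi_R(\ell)=\ell|_R$. $\mathfrak{M}$ is the category of probability spaces and measure preserving measurable maps. A cone over $(R^a,\mu_R,\pi_{RF})$ is a probability space with measure preserving maps $\phi_R$ to the $R^a$ satisfying $\phi_R=\pi_{RF}\circ\phi_F$ for $R\le F$; it is a realization of the limit if every other cone factors through it by a unique measure preserving map compatible with the maps of the cones. The diagram is convergent if there is a measure on the set-theoretic projective limit $\{(\ell_R)_R\in\prod_R R^a:\ell_F|_R=\ell_R,\ R\le F\}$, with the $\sigma$-algebra generated by the coordinate projections, whose image under each coordinate projection to $R^a$ is $\mu_R$. $\mathfrak{Ban}$ is the category of Banach spaces with linear isometries (not necessarily surjective) as morphisms; $L^p$ spaces are of real-valued functions, and $f^*(u)=u\circ f$. A cocone of a codiagram $(Z_R,\varphi_{RF}:Z_R\to Z_F)$ is a Banach space $Y$ with linear isometries $\psi_R:Z_R\to Y$ satisfying $\psi_R=\psi_F\circ\varphi_{RF}$ for $R\le F$; it is the colimit if for every cocone $(Y',\rho_R)$ there is a unique linear isometry $\varphi:Y\to Y'$ with $\varphi\circ\psi_R=\rho_R$ for all $R$. *)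

theory Defs
  imports "HOL-Probability.Probability"
begin

section \<open>Algebraic duals and finite dimensional subspaces\<close>

text \<open>
  Functionals on a subspace \<open>V\<close> are total functions that are \<open>undefined\<close> off \<open>V\<close>, so
  that equality of functions is equality of functionals on \<open>V\<close>. The restriction
  maps \<open>E\<^sup>a \<rightarrow> R\<^sup>a\<close> and \<open>F\<^sup>a \<rightarrow> R\<^sup>a\<close> are both \<open>\<lambda>l. restrict l R\<close>. The space \<open>E\<close>
  itself is a type, and \<open>E\<^sup>a\<close> is \<open>alg_dual UNIV\<close>.
\<close>

definition alg_dual :: "'a::real_vector set \<Rightarrow> ('a \<Rightarrow> real) set" where
  "alg_dual V = {l \<in> extensional V.
     (\<forall>x\<in>V. \<forall>y\<in>V. l (x + y) = l x + l y) \<and> (\<forall>c. \<forall>x\<in>V. l (c *\<^sub>R x) = c * l x)}"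

lemma alg_dual_UNIV: "alg_dual UNIV = {l. linear l}"
  by (auto simp: alg_dual_def linear_iff)

definition fin_subspaces :: "'a::real_vector set set" where
  "fin_subspaces = {R. subspace R \<and> (\<exists>B. finite B \<and> span B = R)}"

definition some_basis :: "'a::real_vector set \<Rightarrow> 'a set" where
  "some_basis R = (SOME B. independent B \<and> span B = R)"

text \<open>
  The Euclidean topology of a finite dimensional space is transported from \<open>\<real>\<^sup>B\<close> by
  the coordinates with respect to a basis \<open>B\<close>; the choice of basis is immaterial.
  On \<open>R\<^sup>a\<close> the coordinates are those with respect to the basis dual to \<open>B\<close>, that is,
  \<open>l \<mapsto> (l b)\<close> for \<open>b \<in> B\<close>.
\<close>

definition euclid_top :: "'a::real_vector set \<Rightarrow> 'a topology" where
  "euclid_top R = pullback_topology R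
     (\<lambda>x. restrict (representation (some_basis R) x) (some_basis R))
     (powertop_real (some_basis R))"

definition euclid_top_dual :: "'a::real_vector set \<Rightarrow> ('a \<Rightarrow> real) topology" where
  "euclid_top_dual R = pullback_topology (alg_dual R)
     (\<lambda>l. restrict l (some_basis R)) (powertop_real (some_basis R))"


section \<open>Characteristic functions and corresponding measures\<close>

definition characteristic_function :: "('a::real_vector \<Rightarrow> complex) \<Rightarrow> bool" where
  "characteristic_function chi \<longleftrightarrow>
     (\<forall>(n::nat) \<xi> \<alpha>. (\<Sum>j<n. \<Sum>k<n. \<alpha> j * cnj (\<alpha> k) * chi (\<xi> j - \<xi> k)) \<in> \<real>\<^sub>\<ge>\<^sub>0) \<and>
     (\<forall>R\<in>fin_subspaces. continuous_map (euclid_top R) euclidean chi)"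

text \<open>As usual, \<open>sigma\<close> is used for the measurable space only; its measure is irrelevant.\<close>

definition dual_algebra :: "('a::real_vector \<Rightarrow> real) measure" where
  "dual_algebra = sigma (alg_dual UNIV)
     {(\<lambda>l. l \<xi>) -` B \<inter> alg_dual UNIV | \<xi> B. B \<in> sets borel}"

definition borel_dual :: "'a::real_vector set \<Rightarrow> ('a \<Rightarrow> real) measure" where
  "borel_dual R = sigma (alg_dual R) {U. openin (euclid_top_dual R) U}"

definition corresponding_measure ::
  "('a::real_vector \<Rightarrow> real) measure \<Rightarrow> 'a set \<Rightarrow> ('a \<Rightarrow> complex) \<Rightarrow> ('a \<Rightarrow> real) measure \<Rightarrow> bool"
where
  "corresponding_measure A V chi \<mu> \<longleftrightarrow> sets \<mu> = sets A \<and>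
     (\<forall>\<xi>\<in>V. has_bochner_integral \<mu> (\<lambda>l. exp (\<i> * complex_of_real (l \<xi>))) (chi \<xi>))"


section \<open>Limits of probability spaces\<close>

text \<open>
  Morphisms out of \<open>N\<close> are functions on \<open>space N\<close>: they are compared pointwise on
  \<open>space N\<close>, not almost everywhere. The transition map \<open>\<pi> R F\<close> goes from \<open>M F\<close> to \<open>M R\<close>.
\<close>

definition mpres :: "'b measure \<Rightarrow> 'c measure \<Rightarrow> ('b \<Rightarrow> 'c) \<Rightarrow> bool" where
  "mpres M N f \<longleftrightarrow> f \<in> measurable M N \<and> distr M N f = N"

definition prob_diagram ::
  "'i::order set \<Rightarrow> ('i \<Rightarrow> 'x measure) \<Rightarrow> ('i \<Rightarrow> 'i \<Rightarrow> 'x \<Rightarrow> 'x) \<Rightarrow> bool" where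
  "prob_diagram I M \<pi> \<longleftrightarrow>
     (\<forall>R\<in>I. prob_space (M R) \<and> (\<forall>x\<in>space (M R). \<pi> R R x = x)) \<and>
     (\<forall>R\<in>I. \<forall>F\<in>I. R \<le> F \<longrightarrow> mpres (M F) (M R) (\<pi> R F)) \<and>
     (\<forall>R\<in>I. \<forall>F\<in>I. \<forall>T\<in>I. R \<le> F \<longrightarrow> F \<le> T \<longrightarrow>
        (\<forall>x\<in>space (M T). \<pi> R T x = \<pi> R F (\<pi> F T x)))"

definition set_proj_limit ::
  "'i::order set \<Rightarrow> ('i \<Rightarrow> 'x measure) \<Rightarrow> ('i \<Rightarrow> 'i \<Rightarrow> 'x \<Rightarrow> 'x) \<Rightarrow> ('i \<Rightarrow> 'x) set" where
  "set_proj_limit I M \<pi> = {l \<in> (\<Pi>\<^sub>E R\<in>I. space (M R)).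
     \<forall>R\<in>I. \<forall>F\<in>I. R \<le> F \<longrightarrow> \<pi> R F (l F) = l R}"

definition convergent_diagram ::
  "'i::order set \<Rightarrow> ('i \<Rightarrow> 'x measure) \<Rightarrow> ('i \<Rightarrow> 'i \<Rightarrow> 'x \<Rightarrow> 'x) \<Rightarrow> bool" where
  "convergent_diagram I M \<pi> \<longleftrightarrow>
     (\<exists>P. sets P = sets (sigma (set_proj_limit I M \<pi>)
            {(\<lambda>l. l R) -` A \<inter> set_proj_limit I M \<pi> | R A. R \<in> I \<and> A \<in> sets (M R)}) \<and>
          (\<forall>R\<in>I. distr P (M R) (\<lambda>l. l R) = M R))"

definition prob_cone ::
  "'i::order set \<Rightarrow> ('i \<Rightarrow> 'x measure) \<Rightarrow> ('i \<Rightarrow> 'i \<Rightarrow> 'x \<Rightarrow> 'x) \<Rightarrow>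
   'b measure \<Rightarrow> ('i \<Rightarrow> 'b \<Rightarrow> 'x) \<Rightarrow> bool" where
  "prob_cone I M \<pi> N \<phi> \<longleftrightarrow> prob_space N \<and> (\<forall>R\<in>I. mpres N (M R) (\<phi> R)) \<and>
     (\<forall>R\<in>I. \<forall>F\<in>I. R \<le> F \<longrightarrow> (\<forall>x\<in>space N. \<phi> R x = \<pi> R F (\<phi> F x)))"

text \<open>
  HOL has no quantification over types inside a formula: the type of points of the
  competing cones is the parameter \<open>'b\<close>, to be left as a free type variable.
\<close>

definition prob_limit ::
  "'b itself \<Rightarrow> 'i::order set \<Rightarrow> ('i \<Rightarrow> 'x measure) \<Rightarrow> ('i \<Rightarrow> 'i \<Rightarrow> 'x \<Rightarrow> 'x) \<Rightarrow>
   'l measure \<Rightarrow> ('i \<Rightarrow> 'l \<Rightarrow> 'x) \<Rightarrow> bool" where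
  "prob_limit _ I M \<pi> L \<phi> \<longleftrightarrow> prob_cone I M \<pi> L \<phi> \<and>
     (\<forall>(N::'b measure) \<psi>. prob_cone I M \<pi> N \<psi> \<longrightarrow>
        (\<exists>!f. f \<in> extensional (space N) \<and> mpres N L f \<and>
              (\<forall>R\<in>I. \<forall>x\<in>space N. \<phi> R (f x) = \<psi> R x)))"


section \<open>Banach spaces and linear isometries\<close>

text \<open>
  Spaces have explicit carriers, since the spaces of a codiagram depend on the index.
\<close>

record 'x nspace =
  vecs :: "'x set"
  vadd :: "'x \<Rightarrow> 'x \<Rightarrow> 'x"
  vscale :: "real \<Rightarrow> 'x \<Rightarrow> 'x"
  vzero :: 'x
  vnorm :: "'x \<Rightarrow> real"

definition vdist :: "'x nspace \<Rightarrow> 'x \<Rightarrow> 'x \<Rightarrow> real" where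
  "vdist V x y = vnorm V (vadd V x (vscale V (-1) y))"

locale real_banach =
  fixes V :: "'x nspace"
  assumes zero_closed: "vzero V \<in> vecs V"
    and add_closed: "\<lbrakk>x \<in> vecs V; y \<in> vecs V\<rbrakk> \<Longrightarrow> vadd V x y \<in> vecs V"
    and scale_closed: "x \<in> vecs V \<Longrightarrow> vscale V c x \<in> vecs V"
    and add_assoc: "\<lbrakk>x \<in> vecs V; y \<in> vecs V; z \<in> vecs V\<rbrakk> \<Longrightarrow>
          vadd V (vadd V x y) z = vadd V x (vadd V y z)"
    and add_commute: "\<lbrakk>x \<in> vecs V; y \<in> vecs V\<rbrakk> \<Longrightarrow> vadd V x y = vadd V y x"
    and add_zero: "x \<in> vecs V \<Longrightarrow> vadd V x (vzero V) = x"
    and add_neg: "x \<in> vecs V \<Longrightarrow> vadd V x (vscale V (-1) x) = vzero V"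
    and scale_add: "\<lbrakk>x \<in> vecs V; y \<in> vecs V\<rbrakk> \<Longrightarrow>
          vscale V c (vadd V x y) = vadd V (vscale V c x) (vscale V c y)"
    and add_scale: "x \<in> vecs V \<Longrightarrow>
          vscale V (c + d) x = vadd V (vscale V c x) (vscale V d x)"
    and scale_scale: "x \<in> vecs V \<Longrightarrow> vscale V c (vscale V d x) = vscale V (c * d) x"
    and scale_one: "x \<in> vecs V \<Longrightarrow> vscale V 1 x = x"
    and norm_nonneg: "x \<in> vecs V \<Longrightarrow> 0 \<le> vnorm V x"
    and norm_eq_zero: "x \<in> vecs V \<Longrightarrow> vnorm V x = 0 \<longleftrightarrow> x = vzero V"
    and norm_triangle: "\<lbrakk>x \<in> vecs V; y \<in> vecs V\<rbrakk> \<Longrightarrow>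
          vnorm V (vadd V x y) \<le> vnorm V x + vnorm V y"
    and norm_scale: "x \<in> vecs V \<Longrightarrow> vnorm V (vscale V c x) = \<bar>c\<bar> * vnorm V x"
    and complete: "\<lbrakk>\<forall>n. s n \<in> vecs V;
          \<forall>e>0. \<exists>N::nat. \<forall>m\<ge>N. \<forall>n\<ge>N. vdist V (s m) (s n) < e\<rbrakk> \<Longrightarrow>
          \<exists>x\<in>vecs V. (\<lambda>n. vdist V (s n) x) \<longlonglongrightarrow> 0"

definition lin_isometry :: "'x nspace \<Rightarrow> 'y nspace \<Rightarrow> ('x \<Rightarrow> 'y) \<Rightarrow> bool" where
  "lin_isometry V W f \<longleftrightarrow> f \<in> vecs V \<rightarrow> vecs W \<and>
     (\<forall>x\<in>vecs V. \<forall>y\<in>vecs V. f (vadd V x y) = vadd W (f x) (f y)) \<and>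
     (\<forall>c. \<forall>x\<in>vecs V. f (vscale V c x) = vscale W c (f x)) \<and>
     (\<forall>x\<in>vecs V. vnorm W (f x) = vnorm V x)"

text \<open>Here \<open>\<phi> R F\<close> goes from \<open>Z R\<close> to \<open>Z F\<close>.\<close>

definition ban_codiagram ::
  "'i::order set \<Rightarrow> ('i \<Rightarrow> 'z nspace) \<Rightarrow> ('i \<Rightarrow> 'i \<Rightarrow> 'z \<Rightarrow> 'z) \<Rightarrow> bool" where
  "ban_codiagram I Z \<phi> \<longleftrightarrow>
     (\<forall>R\<in>I. real_banach (Z R) \<and> (\<forall>z\<in>vecs (Z R). \<phi> R R z = z)) \<and>
     (\<forall>R\<in>I. \<forall>F\<in>I. R \<le> F \<longrightarrow> lin_isometry (Z R) (Z F) (\<phi> R F)) \<and>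
     (\<forall>R\<in>I. \<forall>F\<in>I. \<forall>T\<in>I. R \<le> F \<longrightarrow> F \<le> T \<longrightarrow>
        (\<forall>z\<in>vecs (Z R). \<phi> R T z = \<phi> F T (\<phi> R F z)))"

definition ban_cocone ::
  "'i::order set \<Rightarrow> ('i \<Rightarrow> 'z nspace) \<Rightarrow> ('i \<Rightarrow> 'i \<Rightarrow> 'z \<Rightarrow> 'z) \<Rightarrow>
   'y nspace \<Rightarrow> ('i \<Rightarrow> 'z \<Rightarrow> 'y) \<Rightarrow> bool" where
  "ban_cocone I Z \<phi> Y \<psi> \<longleftrightarrow> real_banach Y \<and> (\<forall>R\<in>I. lin_isometry (Z R) Y (\<psi> R)) \<and>
     (\<forall>R\<in>I. \<forall>F\<in>I. R \<le> F \<longrightarrow> (\<forall>z\<in>vecs (Z R). \<psi> R z = \<psi> F (\<phi> R F z)))"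

definition ban_colimit ::
  "'c itself \<Rightarrow> 'i::order set \<Rightarrow> ('i \<Rightarrow> 'z nspace) \<Rightarrow> ('i \<Rightarrow> 'i \<Rightarrow> 'z \<Rightarrow> 'z) \<Rightarrow>
   'y nspace \<Rightarrow> ('i \<Rightarrow> 'z \<Rightarrow> 'y) \<Rightarrow> bool" where
  "ban_colimit _ I Z \<phi> Y \<psi> \<longleftrightarrow> ban_cocone I Z \<phi> Y \<psi> \<and>
     (\<forall>(Y'::'c nspace) \<rho>. ban_cocone I Z \<phi> Y' \<rho> \<longrightarrow>
        (\<exists>!f. f \<in> extensional (vecs Y) \<and> lin_isometry Y Y' f \<and>
              (\<forall>R\<in>I. \<forall>z\<in>vecs (Z R). f (\<psi> R z) = \<rho> R z)))"


section \<open>The spaces \<open>L\<^sup>p\<close>\<close>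

definition Lp_fun :: "'x measure \<Rightarrow> real \<Rightarrow> ('x \<Rightarrow> real) set" where
  "Lp_fun M p = {f \<in> borel_measurable M. integrable M (\<lambda>x. \<bar>f x\<bar> powr p)}"

definition ae_rel :: "'x measure \<Rightarrow> real \<Rightarrow> (('x \<Rightarrow> real) \<times> ('x \<Rightarrow> real)) set" where
  "ae_rel M p = {(f, g). f \<in> Lp_fun M p \<and> g \<in> Lp_fun M p \<and> (AE x in M. f x = g x)}"

text \<open>
  The vectors are the classes of almost everywhere equal functions; the unions and
  images below range over the representatives of the given classes.
\<close>

definition Lp :: "'x measure \<Rightarrow> real \<Rightarrow> ('x \<Rightarrow> real) set nspace" where
  "Lp M p = \<lparr>
     vecs = Lp_fun M p // ae_rel M p,
     vadd = (\<lambda>U V. \<Union>u\<in>U. \<Union>v\<in>V. ae_rel M p `` {\<lambda>x. u x + v x}),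
     vscale = (\<lambda>c U. \<Union>u\<in>U. ae_rel M p `` {\<lambda>x. c * u x}),
     vzero = ae_rel M p `` {\<lambda>x. 0},
     vnorm = (\<lambda>U. the_elem ((\<lambda>u. (\<integral>x. \<bar>u x\<bar> powr p \<partial>M) powr (1 / p)) ` U))\<rparr>"

definition Lp_pull ::
  "'x measure \<Rightarrow> real \<Rightarrow> ('x \<Rightarrow> 'y) \<Rightarrow> ('y \<Rightarrow> real) set \<Rightarrow> ('x \<Rightarrow> real) set" where
  "Lp_pull M p f U = (\<Union>u\<in>U. ae_rel M p `` {u \<circ> f})"

end

theory Submission
  imports Defs
begin

text \<open>
  A measure on the dual of a subspace is determined by its characteristic function. This one fact
  carries the measure theoretic half of the theorem: to see that a map into a dual preserves
  measures it suffices to compute the characteristic function of the image measure, and for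
  restriction maps, and for the map that a cone induces, this computation is immediate.

  A cone \<open>(N, \<psi>)\<close> factors through \<open>E\<^sup>a\<close> pointwise: the functionals \<open>\<psi>\<^sub>R x\<close> agree on common
  subspaces, so they glue to one linear functional on \<open>E\<close>, and \<open>\<xi> \<mapsto> \<psi> (span {\<xi>}) x \<xi>\<close> is the only
  candidate. Convergence of the diagram follows from the existence of the cone \<open>E\<^sup>a\<close>, whose
  measure is pushed forward to the set-theoretic limit.

  Uniqueness of measures in several variables is reduced to Levy's theorem on the line
  (\<open>rectangles_determined_by_characters\<close>): the variables are split off one at a time, the
  characters in the others being treated as bounded weights. The Borel algebra of \<open>R\<^sup>a\<close> is
  generated by evaluations, hence \<open>R\<^sup>a\<close> and \<open>E\<^sup>a\<close> are covered by the same uniqueness statement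
  (\<open>corresponding_measure_unique\<close>).

  For the spaces \<open>L\<^sup>p\<close>, pulling back along a measure preserving map is an isometry, which gives
  the codiagram and the cocone. The colimit property is then a matter of density. A cocone over a
  directed codiagram whose images are dense in its apex is a colimit, because compatible isometries
  on the union of the images extend uniquely to the closure (\<open>ban_colimit_of_dense_union\<close>).
  The functions pulled back from finite dimensional duals are dense in \<open>L\<^sup>p(E\<^sup>a, \<mu>)\<close> since
  the cylinder sets form a \<open>\<pi>\<close>-system that generates the \<open>\<sigma>\<close>-algebra (\<open>pullbacks_dense_in_Lp\<close>).
\<close>


section \<open>Characteristic functions determine finite measures\<close>

text \<open>
  Equal characteristic functions have equal values at \<open>0\<close>, so both measures have the same mass. If it
  is positive, they can be normalized to probability measures, and for these this is Levy's
  uniqueness theorem.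
\<close>
lemma finite_measure_char_unique:
  assumes "finite_measure M" "finite_measure N"
    and sets: "sets M = sets (borel :: real measure)" "sets N = sets borel"
    and char: "\<And>t. char M t = char N t"
  shows "M = N"
proof -
  interpret M: finite_measure M by fact
  interpret N: finite_measure N by fact
  have space: "space M = UNIV" "space N = UNIV"
    using sets[THEN sets_eq_imp_space_eq] by simp_all
  define m where "m = measure M UNIV"
  have m: "measure N UNIV = m"
    using char[of 0] by (simp add: char_def space m_def)
  show ?thesis
  proof (cases "m = 0")
    case True
    then have "emeasure M UNIV = 0" "emeasure N UNIV = 0"
      using m by (simp_all add: m_def M.emeasure_eq_measure N.emeasure_eq_measure)
    then have "emeasure M A = 0" "emeasure N A = 0" for A
      using emeasure_mono[of A UNIV M] emeasure_mono[of A UNIV N] sets by auto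
    then show ?thesis
      by (intro measure_eqI) (auto simp: sets)
  next
    case False
    then have m_pos: "m > 0"
      by (simp add: m_def zero_less_measure_iff)
    have norm: "real_distribution (density K (\<lambda>_. ennreal (1 / m)))"
      if "finite_measure K" "sets K = sets borel" "measure K UNIV = m" for K :: "real measure"
    proof -
      interpret K: finite_measure K by fact
      have "space K = UNIV"
        using that(2)[THEN sets_eq_imp_space_eq] by simp
      then have "emeasure (density K (\<lambda>_. ennreal (1 / m))) UNIV = 1"
        using m_pos that(2,3)
        by (simp add: emeasure_density_const K.emeasure_eq_measure flip: ennreal_mult)
      then show ?thesis
        using that(2) \<open>space K = UNIV\<close>
        by (intro real_distribution.intro real_distribution_axioms.intro prob_spaceI)
           (simp_all add: space_density)
    qed
    have "char (density M (\<lambda>_. ennreal (1 / m))) = char (density N (\<lambda>_. ennreal (1 / m)))"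
    proof
      fix t
      have "char (density K (\<lambda>_. ennreal (1 / m))) t = (1 / m) *\<^sub>R char K t"
        if "sets K = sets borel" for K :: "real measure"
      proof -
        have [measurable_cong]: "sets K = sets borel" by fact
        show ?thesis
          unfolding char_def using m_pos by (subst integral_density) auto
      qed
      then show "char (density M (\<lambda>_. ennreal (1 / m))) t
          = char (density N (\<lambda>_. ennreal (1 / m))) t"
        using char sets by simp
    qed
    then have eq: "density M (\<lambda>_. ennreal (1 / m)) = density N (\<lambda>_. ennreal (1 / m))"
      using norm sets m assms(1,2) m_def by (intro Levy_uniqueness) auto
    show ?thesis
    proof (rule measure_eqI)
      fix A assume A: "A \<in> sets M"
      then have "ennreal (1 / m) * emeasure M A = ennreal (1 / m) * emeasure N A"
        using arg_cong[OF eq, of "\<lambda>K. emeasure K A"] sets by (simp add: emeasure_density_const)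
      then show "emeasure M A = emeasure N A"
        using m_pos by (simp add: ennreal_mult_cancel_left)
    qed (simp add: sets)
  qed
qed

text \<open>
  The hypothesis compares the characteristic functions of the laws of \<open>X\<close> under the measures with
  density \<open>g\<close>.
\<close>
lemma real_weighted_law_unique:
  fixes X g :: "'x \<Rightarrow> real"
  assumes "finite_measure M" "finite_measure N" and sets_eq: "sets N = sets M"
    and [measurable]: "X \<in> borel_measurable M" "g \<in> borel_measurable M" "A \<in> sets borel"
    and g: "\<And>x. 0 \<le> g x" "\<And>x. g x \<le> c"
    and char: "\<And>t. (\<integral>x. g x *\<^sub>R iexp (t * X x) \<partial>M) = (\<integral>x. g x *\<^sub>R iexp (t * X x) \<partial>N)"
  shows "(\<integral>x. g x * indicator A (X x) \<partial>M) = (\<integral>x. g x * indicator A (X x) \<partial>N)"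
proof -
  have [measurable_cong]: "sets N = sets M" by fact
  interpret M: finite_measure M by fact
  interpret N: finite_measure N by fact
  let ?law = "\<lambda>K. distr (density K (\<lambda>x. ennreal (g x))) borel X"
  have law: "finite_measure (?law K)" "char (?law K) t = (\<integral>x. g x *\<^sub>R iexp (t * X x) \<partial>K)"
      "emeasure (?law K) A = ennreal (\<integral>x. g x * indicator A (X x) \<partial>K)"
    if "finite_measure K" "sets K = sets M" for K t
  proof -
    have [measurable_cong]: "sets K = sets M" by fact
    interpret K: finite_measure K by fact
    have int: "integrable K (\<lambda>x. g x * indicator B (X x))" if [measurable]: "B \<in> sets borel" for B
      using g by (intro K.integrable_const_bound[of _ c]) (auto simp: indicator_def intro: order_trans)
    have em: "emeasure (?law K) B = ennreal (\<integral>x. g x * indicator B (X x) \<partial>K)"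
      if [measurable]: "B \<in> sets borel" for B
    proof -
      have "emeasure (?law K) B
          = (\<integral>\<^sup>+x. ennreal (g x) * indicator (X -` B \<inter> space K) x \<partial>K)"
        by (subst emeasure_distr) (auto simp: emeasure_density space_density)
      also have "\<dots> = (\<integral>\<^sup>+x. ennreal (g x * indicator B (X x)) \<partial>K)"
        by (intro nn_integral_cong) (auto simp: indicator_def)
      also have "\<dots> = ennreal (\<integral>x. g x * indicator B (X x) \<partial>K)"
        using int g by (intro nn_integral_eq_integral) auto
      finally show ?thesis .
    qed
    show "emeasure (?law K) A = ennreal (\<integral>x. g x * indicator A (X x) \<partial>K)"
      by (rule em) simp
    show "finite_measure (?law K)"
      using em[of UNIV] by (intro finite_measureI) simp
    show "char (?law K) t = (\<integral>x. g x *\<^sub>R iexp (t * X x) \<partial>K)"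
      unfolding char_def using g by (subst integral_distr) (auto simp: integral_density)
  qed
  have "?law M = ?law N"
    using char by (intro finite_measure_char_unique) (auto simp: law assms(1-3))
  then have "ennreal (\<integral>x. g x * indicator A (X x) \<partial>M) = ennreal (\<integral>x. g x * indicator A (X x) \<partial>N)"
    using law(3)[of M] law(3)[of N] assms(1-3) by simp
  then show ?thesis
    using g by (subst (asm) ennreal_inj) (auto intro!: integral_nonneg_AE)
qed

lemma finite_measure_integrable_bounded:
  fixes h :: "'x \<Rightarrow> 'b::{banach,second_countable_topology}"
  assumes "finite_measure K" "sets K = sets M" "h \<in> borel_measurable M" "\<And>x. norm (h x) \<le> C"
  shows "integrable K h"
  using assms by (intro finite_measure.integrable_const_bound[of _ _ C])
    (auto cong: measurable_cong_sets)

text \<open>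
  The real and imaginary part of \<open>g\<close> are combinations of \<open>g\<close> and its conjugate. If \<open>h\<close> is one of
  them then \<open>1 + h\<close> is a nonnegative weight, and the constant weight \<open>1\<close> can be subtracted again.
\<close>
lemma complex_weighted_law_unique:
  fixes X :: "'x \<Rightarrow> real" and g :: "'x \<Rightarrow> complex"
  assumes "finite_measure M" "finite_measure N" and sets_eq: "sets N = sets M"
    and [measurable]: "X \<in> borel_measurable M" "g \<in> borel_measurable M" "A \<in> sets borel"
    and g: "\<And>x. norm (g x) \<le> 1"
    and char1: "\<And>t. (\<integral>x. iexp (t * X x) \<partial>M) = (\<integral>x. iexp (t * X x) \<partial>N)"
    and charg: "\<And>t. (\<integral>x. g x * iexp (t * X x) \<partial>M) = (\<integral>x. g x * iexp (t * X x) \<partial>N)"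
    and charc: "\<And>t. (\<integral>x. cnj (g x) * iexp (t * X x) \<partial>M) = (\<integral>x. cnj (g x) * iexp (t * X x) \<partial>N)"
  shows "(\<integral>x. indicator A (X x) *\<^sub>R g x \<partial>M) = (\<integral>x. indicator A (X x) *\<^sub>R g x \<partial>N)"
proof -
  have [measurable_cong]: "sets N = sets M" by fact
  note fin = assms(1,2)
  have [measurable]: "(\<lambda>x. cnj (g x)) \<in> borel_measurable M"
    by (rule borel_measurable_continuous_on[where f=cnj]) (auto intro: continuous_intros)
  note bound = finite_measure_integrable_bounded
  have gRe: "\<bar>Re (g x)\<bar> \<le> 1" and gIm: "\<bar>Im (g x)\<bar> \<le> 1" for x
    using g[of x] abs_Re_le_cmod[of "g x"] abs_Im_le_cmod[of "g x"] by linarith+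
  have ReIm: "(\<integral>x. h x * indicator A (X x) \<partial>M) = (\<integral>x. h x * indicator A (X x) \<partial>N)"
    if [measurable]: "h \<in> borel_measurable M" and h: "\<And>x. \<bar>h x\<bar> \<le> (1::real)"
      and ab: "\<And>x. complex_of_real (h x) = a * g x + b * cnj (g x)" for h a b
  proof -
    have iexp_h: "(\<integral>x. (1 + h x) *\<^sub>R iexp (t * X x) \<partial>K) = (\<integral>x. iexp (t * X x) \<partial>K) +
        (a * (\<integral>x. g x * iexp (t * X x) \<partial>K) + b * (\<integral>x. cnj (g x) * iexp (t * X x) \<partial>K))"
      if "finite_measure K" "sets K = sets M" for K t
    proof -
      have [measurable_cong]: "sets K = sets M" by fact
      have i: "integrable K (\<lambda>x. iexp (t * X x))" "integrable K (\<lambda>x. g x * iexp (t * X x))"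
        "integrable K (\<lambda>x. cnj (g x) * iexp (t * X x))"
        using g by (auto intro!: bound[OF that, where C=1] simp: norm_mult)
      have "(\<integral>x. (1 + h x) *\<^sub>R iexp (t * X x) \<partial>K) = (\<integral>x. iexp (t * X x) +
          (a * (g x * iexp (t * X x)) + b * (cnj (g x) * iexp (t * X x))) \<partial>K)"
        by (simp add: scaleR_conv_of_real ab algebra_simps)
      then show ?thesis
        using i by simp
    qed
    have h0: "0 \<le> 1 + h x" and h2: "1 + h x \<le> 2" for x
      using h[of x] by linarith+
    have "(\<integral>x. (1 + h x) * indicator A (X x) \<partial>M) = (\<integral>x. (1 + h x) * indicator A (X x) \<partial>N)"
      using h0 h2 iexp_h[of M] iexp_h[of N] fin sets_eq char1 charg charc
      by (intro real_weighted_law_unique[where c = 2]) auto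
    moreover have "(\<integral>x. (1::real) * indicator A (X x) \<partial>M) = (\<integral>x. (1::real) * indicator A (X x) \<partial>N)"
      using fin sets_eq char1 by (intro real_weighted_law_unique[where g = "\<lambda>_. 1" and c = 1]) auto
    moreover have "(\<integral>x. h x * indicator A (X x) \<partial>K) =
        (\<integral>x. (1 + h x) * indicator A (X x) \<partial>K) - (\<integral>x. (1::real) * indicator A (X x) \<partial>K)"
      if "finite_measure K" "sets K = sets M" for K
    proof -
      have [measurable_cong]: "sets K = sets M" by fact
      have "integrable K (\<lambda>x. (1 + h x) * indicator A (X x))" "integrable K (\<lambda>x. (1::real) * indicator A (X x))"
        using h0 h2 by (auto intro!: bound[OF that, where C=2] simp: abs_mult indicator_def)
      from Bochner_Integration.integral_diff[OF this] show ?thesis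
        by (simp add: algebra_simps)
    qed
    ultimately show ?thesis
      using fin sets_eq by simp
  qed
  have Re: "(\<integral>x. Re (g x) * indicator A (X x) \<partial>M) = (\<integral>x. Re (g x) * indicator A (X x) \<partial>N)"
    by (rule ReIm[where a="1/2" and b="1/2"]) (auto simp: gRe complex_eq_iff)
  have Im: "(\<integral>x. Im (g x) * indicator A (X x) \<partial>M) = (\<integral>x. Im (g x) * indicator A (X x) \<partial>N)"
    by (rule ReIm[where a="-\<i>/2" and b="\<i>/2"]) (auto simp: gIm complex_eq_iff)
  have int: "integrable K (\<lambda>x. indicator A (X x) *\<^sub>R g x)" if "finite_measure K" "sets K = sets M" for K
    using g by (intro bound[OF that, where C=1]) (auto simp: indicator_def)
  show ?thesis
    using Re Im int[of M] int[of N] fin sets_eq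
    by (intro complex_eqI)
       (simp_all add: mult.commute flip: integral_Re integral_Im)
qed

text \<open>
  Induction on the number of variables. For fixed coefficients \<open>r\<close> of the variables in \<open>B\<close>, letting
  the coefficient of the new variable \<open>X b\<close> run through the reals shows that the law of \<open>X b\<close>
  weighted by the character \<open>iexp (\<Sum>b\<in>B. r b * X b x)\<close> is the same for both measures. Hence both
  measures, cut down to the event \<open>X b x \<in> A b\<close>, satisfy the hypothesis for \<open>B\<close>.
\<close>
lemma rectangles_determined_by_characters:
  fixes X :: "'b \<Rightarrow> 'x \<Rightarrow> real"
  assumes "finite B" "finite_measure M" "finite_measure N" "sets N = sets M"
    and "\<And>b. b \<in> B \<Longrightarrow> X b \<in> borel_measurable M" "\<And>b. b \<in> B \<Longrightarrow> A b \<in> sets borel"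
    and "\<And>r. (\<integral>x. iexp (\<Sum>b\<in>B. r b * X b x) \<partial>M) = (\<integral>x. iexp (\<Sum>b\<in>B. r b * X b x) \<partial>N)"
  shows "measure M {x\<in>space M. \<forall>b\<in>B. X b x \<in> A b} = measure N {x\<in>space M. \<forall>b\<in>B. X b x \<in> A b}"
  using assms
proof (induction B arbitrary: M N rule: finite_induct)
  case empty
  then show ?case
    using sets_eq_imp_space_eq[OF empty.prems(3)] by simp
next
  case (insert b B)
  have [measurable_cong]: "sets N = sets M" by fact
  have space: "space N = space M"
    by (rule sets_eq_imp_space_eq) fact
  have [measurable]: "\<And>b'. b' \<in> B \<Longrightarrow> X b' \<in> borel_measurable M" "X b \<in> borel_measurable M"
    "A b \<in> sets borel" "\<And>b'. b' \<in> B \<Longrightarrow> A b' \<in> sets borel"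
    using insert.prems by auto
  define cut where "cut K = density K (\<lambda>x. indicator {x \<in> space M. X b x \<in> A b} x)" for K
  let ?S = "\<lambda>r x. \<Sum>b'\<in>B. r b' * X b' x"
  have cut: "finite_measure (cut K)" "sets (cut K) = sets M"
      "(\<integral>x. iexp (?S r x) \<partial>(cut K)) = (\<integral>x. indicator (A b) (X b x) *\<^sub>R iexp (?S r x) \<partial>K)"
      "measure (cut K) {x\<in>space M. \<forall>b'\<in>B. X b' x \<in> A b'}
        = measure K {x\<in>space M. \<forall>b'\<in>insert b B. X b' x \<in> A b'}"
    if "finite_measure K" "sets K = sets M" for K r
  proof -
    have [measurable_cong]: "sets K = sets M" by fact
    have spK: "space K = space M"
      by (rule sets_eq_imp_space_eq) fact
    interpret K: finite_measure K by fact
    have em: "emeasure (cut K) C = emeasure K ({x \<in> space M. X b x \<in> A b} \<inter> C)"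
      if "C \<in> sets M" for C
      unfolding cut_def using that
      by (subst emeasure_density) (auto simp: indicator_inter_arith[symmetric] \<open>sets K = sets M\<close>)
    show "sets (cut K) = sets M"
      by (simp add: cut_def that)
    then have "space (cut K) = space M"
      by (rule sets_eq_imp_space_eq)
    then show "finite_measure (cut K)"
      by (intro finite_measureI) (simp add: em)
    show "(\<integral>x. iexp (?S r x) \<partial>(cut K)) = (\<integral>x. indicator (A b) (X b x) *\<^sub>R iexp (?S r x) \<partial>K)"
    proof -
      have "(\<integral>x. iexp (?S r x) \<partial>(cut K))
          = (\<integral>x. indicator {x \<in> space M. X b x \<in> A b} x *\<^sub>R iexp (?S r x) \<partial>K)"
        unfolding cut_def ennreal_indicator[symmetric] by (subst integral_density) auto
      then show ?thesis
        by (auto simp: indicator_def spK intro!: Bochner_Integration.integral_cong)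
    qed
    have "{x\<in>space M. \<forall>b'\<in>B. X b' x \<in> A b'} \<in> sets M"
      using \<open>finite B\<close> by measurable
    then show "measure (cut K) {x\<in>space M. \<forall>b'\<in>B. X b' x \<in> A b'}
        = measure K {x\<in>space M. \<forall>b'\<in>insert b B. X b' x \<in> A b'}"
      unfolding measure_def
      by (subst em) (auto intro!: arg_cong[where f="\<lambda>C. enn2real (emeasure K C)"])
  qed
  note MN = insert.prems(1-3)
  have joint: "(\<integral>x. iexp (?S r x) * iexp (t * X b x) \<partial>M) = (\<integral>x. iexp (?S r x) * iexp (t * X b x) \<partial>N)"
    for r t
  proof -
    have "iexp (?S r x) * iexp (t * X b x) = iexp (\<Sum>b'\<in>insert b B. (r(b := t)) b' * X b' x)" for x
    proof -
      have "(\<Sum>b'\<in>insert b B. (r(b := t)) b' * X b' x) = t * X b x + ?S r x"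
        using insert.hyps by (subst sum.insert) (auto intro!: sum.cong)
      then show ?thesis
        by (simp add: exp_add[symmetric] algebra_simps)
    qed
    then show ?thesis
      using insert.prems(6)[of "r(b := t)"] by simp
  qed
  have "(\<integral>x. indicator (A b) (X b x) *\<^sub>R iexp (?S r x) \<partial>M)
      = (\<integral>x. indicator (A b) (X b x) *\<^sub>R iexp (?S r x) \<partial>N)" for r
  proof (rule complex_weighted_law_unique[OF MN])
    show "(\<integral>x. iexp (t * X b x) \<partial>M) = (\<integral>x. iexp (t * X b x) \<partial>N)" for t
      using joint[of "\<lambda>_. 0" t] by simp
    show "(\<integral>x. cnj (iexp (?S r x)) * iexp (t * X b x) \<partial>M)
        = (\<integral>x. cnj (iexp (?S r x)) * iexp (t * X b x) \<partial>N)" for t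
    proof -
      have "cnj (iexp (?S r x)) = iexp (?S (\<lambda>b. - r b) x)" for x
        by (simp add: exp_cnj sum_negf)
      then show ?thesis
        using joint[of "\<lambda>b. - r b" t] by simp
    qed
  qed (use joint in auto)
  then have "(\<integral>x. iexp (?S r x) \<partial>(cut M)) = (\<integral>x. iexp (?S r x) \<partial>(cut N))" for r
    using MN cut(3)[of M r] cut(3)[of N r] by simp
  then have "measure (cut M) {x\<in>space (cut M). \<forall>b'\<in>B. X b' x \<in> A b'}
      = measure (cut N) {x\<in>space (cut M). \<forall>b'\<in>B. X b' x \<in> A b'}"
    using MN insert.prems(4,5)
    by (intro insert.IH) (auto simp: cut cong: measurable_cong_sets)
  then show ?case
    using MN cut(4)[of M] cut(4)[of N] sets_eq_imp_space_eq[OF cut(2)[of M]] by simp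
qed


section \<open>Dual spaces and their measures\<close>

text \<open>
  The \<open>\<sigma>\<close>-algebra generated by evaluations. It gives the duals of finite dimensional subspaces and
  of the whole space a common description, so that each fact below is proved once for both.
\<close>
definition eval_algebra :: "'a::real_vector set \<Rightarrow> ('a \<Rightarrow> real) measure" where
  "eval_algebra V = sigma (alg_dual V) {(\<lambda>l. l \<xi>) -` B \<inter> alg_dual V | \<xi> B. \<xi> \<in> V \<and> B \<in> sets borel}"

lemma dual_algebra_eq_eval_algebra: "dual_algebra = eval_algebra UNIV"
  by (simp add: dual_algebra_def eval_algebra_def)

lemma space_eval_algebra: "space (eval_algebra V) = alg_dual V"
  unfolding eval_algebra_def by (rule space_measure_of) auto

lemma sets_eval_algebra:
  "sets (eval_algebra V)
    = sigma_sets (alg_dual V) {(\<lambda>l. l \<xi>) -` B \<inter> alg_dual V | \<xi> B. \<xi> \<in> V \<and> B \<in> sets borel}"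
  unfolding eval_algebra_def by (rule sets_measure_of) auto

lemma measurable_eval: "\<xi> \<in> V \<Longrightarrow> (\<lambda>l. l \<xi>) \<in> borel_measurable (eval_algebra V)"
  by (rule measurableI) (auto simp: space_eval_algebra sets_eval_algebra)

lemma measurable_into_eval_algebra:
  assumes "f \<in> space M \<rightarrow> alg_dual V"
    and "\<And>\<xi>. \<xi> \<in> V \<Longrightarrow> (\<lambda>x. f x \<xi>) \<in> borel_measurable M"
  shows "f \<in> measurable M (eval_algebra V)"
  unfolding eval_algebra_def
proof (rule measurable_measure_of)
  fix A assume "A \<in> {(\<lambda>l. l \<xi>) -` B \<inter> alg_dual V | \<xi> B. \<xi> \<in> V \<and> B \<in> sets borel}"
  then obtain \<xi> B where A: "A = (\<lambda>l. l \<xi>) -` B \<inter> alg_dual V" "\<xi> \<in> V" "B \<in> sets borel"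
    by blast
  then have "f -` A \<inter> space M = (\<lambda>x. f x \<xi>) -` B \<inter> space M"
    using assms(1) by auto
  then show "f -` A \<inter> space M \<in> sets M"
    using A assms(2) by (simp add: measurable_sets)
qed (use assms(1) in auto)

lemma alg_dual_zero: "l \<in> alg_dual V \<Longrightarrow> 0 \<in> V \<Longrightarrow> l 0 = 0"
  unfolding alg_dual_def by (metis (mono_tags, lifting) mem_Collect_eq mult_zero_left scale_zero_left)

lemma alg_dual_sum:
  assumes "l \<in> alg_dual V" "subspace V" "finite B" "B \<subseteq> V"
  shows "l (\<Sum>b\<in>B. r b *\<^sub>R b) = (\<Sum>b\<in>B. r b * l b)"
  using assms(3,4)
proof (induction B rule: finite_induct)
  case empty
  then show ?case
    using alg_dual_zero[OF assms(1)] assms(2) by (simp add: subspace_0)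
next
  case (insert b B)
  then have "r b *\<^sub>R b \<in> V" "(\<Sum>b\<in>B. r b *\<^sub>R b) \<in> V"
    using assms(2) by (auto intro!: subspace_sum subspace_scale)
  then show ?case
    using insert assms(1) by (simp add: alg_dual_def)
qed

lemma restrict_alg_dual:
  "l \<in> alg_dual V \<Longrightarrow> subspace W \<Longrightarrow> W \<subseteq> V \<Longrightarrow> restrict l W \<in> alg_dual W"
  by (auto simp: alg_dual_def subspace_add subspace_scale subset_iff)

lemma measurable_restrict_eval_algebra:
  "subspace W \<Longrightarrow> W \<subseteq> V \<Longrightarrow> (\<lambda>l. restrict l W) \<in> measurable (eval_algebra V) (eval_algebra W)"
  by (rule measurable_into_eval_algebra)
     (auto simp: space_eval_algebra intro: restrict_alg_dual measurable_eval)

lemma restrict_alg_dual_self: "l \<in> alg_dual V \<Longrightarrow> restrict l V = l"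
  by (auto simp: alg_dual_def extensional_restrict)

lemma fin_subspaces_basis:
  assumes "R \<in> fin_subspaces"
  shows "finite (some_basis R)" "independent (some_basis R)" "span (some_basis R) = R"
proof -
  obtain S where S: "finite S" "span S = R"
    using assms by (auto simp: fin_subspaces_def)
  obtain B where B: "B \<subseteq> R" "independent B" "R \<subseteq> span B"
    by (rule maximal_independent_subset)
  moreover have "span B \<subseteq> R"
    using B(1) assms by (auto simp: fin_subspaces_def intro: span_minimal[THEN subsetD])
  ultimately have "\<exists>B. independent B \<and> span B = R"
    by blast
  then show *: "independent (some_basis R)" "span (some_basis R) = R"
    unfolding some_basis_def by (metis (mono_tags, lifting) someI_ex)+
  show "finite (some_basis R)"
    using independent_span_bound[OF S(1) *(1)] span_superset[of "some_basis R"] *(2) S(2) by auto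
qed

lemma fin_subspaces_subspace: "R \<in> fin_subspaces \<Longrightarrow> subspace R"
  by (simp add: fin_subspaces_def)

lemma span_in_fin_subspaces: "finite S \<Longrightarrow> span S \<in> fin_subspaces"
  by (auto simp: fin_subspaces_def)

lemma fin_subspaces_directed:
  assumes "R \<in> fin_subspaces" "F \<in> fin_subspaces"
  shows "\<exists>T\<in>fin_subspaces. R \<le> T \<and> F \<le> T"
proof -
  from assms obtain A B where AB: "finite A" "span A = R" "finite B" "span B = F"
    by (auto simp: fin_subspaces_def)
  then have "R \<le> span (A \<union> B)" "F \<le> span (A \<union> B)"
    using span_mono[of A "A \<union> B"] span_mono[of B "A \<union> B"] by auto
  then show ?thesis
    using span_in_fin_subspaces[of "A \<union> B"] AB by blast
qed

lemma topspace_euclid_top_dual: "topspace (euclid_top_dual R) = alg_dual R"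
  by (auto simp: euclid_top_dual_def topspace_pullback_topology)

lemma space_borel_dual: "space (borel_dual R) = alg_dual R"
  unfolding borel_dual_def using openin_subset[of "euclid_top_dual R"]
  by (intro space_measure_of) (auto simp: topspace_euclid_top_dual)

lemma sets_borel_dual: "sets (borel_dual R) = sigma_sets (alg_dual R) {U. openin (euclid_top_dual R) U}"
  unfolding borel_dual_def using openin_subset[of "euclid_top_dual R"]
  by (intro sets_measure_of) (auto simp: topspace_euclid_top_dual)

text \<open>
  In the coordinates of a finite basis, an open set is a countable union of boxes with sides from a
  countable basis of the real line, and a box is a finite intersection of conditions on evaluations.
\<close>
lemma openin_euclid_top_dual_eval_algebra:
  assumes R: "R \<in> fin_subspaces" and U: "openin (euclid_top_dual R) U"
  shows "U \<in> sets (eval_algebra R)"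
proof -
  let ?B = "some_basis R"
  note B = fin_subspaces_basis[OF R]
  have B_sub: "?B \<subseteq> R"
    using span_superset[of ?B] B(3) by simp
  obtain W where W: "openin (powertop_real ?B) W" "U = (\<lambda>l. restrict l ?B) -` W \<inter> alg_dual R"
    using U by (auto simp: euclid_top_dual_def openin_pullback_topology)
  obtain K :: "real set set" where K: "countable K" "topological_basis K"
    using ex_countable_basis by blast
  define boxes where "boxes = {V \<in> ?B \<rightarrow>\<^sub>E K. Pi\<^sub>E ?B V \<subseteq> W}"
  have "countable boxes"
    using countable_PiE[OF B(1), of "\<lambda>_. K", OF K(1)]
    by (rule countable_subset[rotated]) (auto simp: boxes_def)
  moreover have "{l \<in> alg_dual R. \<forall>b\<in>?B. l b \<in> V b} \<in> sets (eval_algebra R)" if "V \<in> boxes" for V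
  proof -
    have [measurable]: "V b \<in> sets borel" "(\<lambda>l. l b) \<in> borel_measurable (eval_algebra R)" if "b \<in> ?B" for b
      using \<open>V \<in> boxes\<close> that B_sub topological_basis_open[OF K(2)]
      by (auto simp: boxes_def PiE_iff intro!: measurable_eval borel_open)
    have "{l \<in> space (eval_algebra R). \<forall>b\<in>?B. l b \<in> V b} \<in> sets (eval_algebra R)"
      using B(1) by measurable
    then show ?thesis
      by (simp add: space_eval_algebra)
  qed
  moreover have "U = (\<Union>V\<in>boxes. {l \<in> alg_dual R. \<forall>b\<in>?B. l b \<in> V b})"
  proof (intro equalityI subsetI)
    fix l assume "l \<in> U"
    then have l: "l \<in> alg_dual R" "restrict l ?B \<in> W"
      using W(2) by auto
    then obtain O' where O': "\<And>b. b \<in> ?B \<Longrightarrow> open (O' b)" "restrict l ?B \<in> Pi\<^sub>E ?B O'" "Pi\<^sub>E ?B O' \<subseteq> W"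
      using W(1)[unfolded openin_product_topology_alt, rule_format, OF l(2)] by auto
    have "\<exists>V\<in>K. l b \<in> V \<and> V \<subseteq> O' b" if "b \<in> ?B" for b
      using topological_basisE[OF K(2) O'(1)[OF that], of "l b"] O'(2) that by (metis PiE_mem restrict_apply')
    then obtain V where V: "\<And>b. b \<in> ?B \<Longrightarrow> V b \<in> K \<and> l b \<in> V b \<and> V b \<subseteq> O' b"
      by metis
    then have "restrict V ?B \<in> boxes"
      unfolding boxes_def using O'(3) PiE_mono[of ?B "restrict V ?B" O'] by auto
    then show "l \<in> (\<Union>V\<in>boxes. {l \<in> alg_dual R. \<forall>b\<in>?B. l b \<in> V b})"
      using l V by (intro UN_I[of "restrict V ?B"]) auto
  next
    fix l assume "l \<in> (\<Union>V\<in>boxes. {l \<in> alg_dual R. \<forall>b\<in>?B. l b \<in> V b})"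
    then obtain V where V: "V \<in> boxes" "l \<in> alg_dual R" "\<forall>b\<in>?B. l b \<in> V b"
      by auto
    then have "restrict l ?B \<in> Pi\<^sub>E ?B V"
      by auto
    then show "l \<in> U"
      using V W(2) by (auto simp: boxes_def)
  qed
  ultimately show ?thesis
    by (metis (no_types, lifting) sets.countable_UN'')
qed

text \<open>
  Evaluation at \<open>\<xi>\<close> is a linear combination of the coordinate functions \<open>l \<mapsto> l b\<close>, which are
  continuous by definition of the topology.
\<close>
lemma measurable_eval_borel_dual:
  assumes R: "R \<in> fin_subspaces" and "\<xi> \<in> R"
  shows "(\<lambda>l. l \<xi>) \<in> borel_measurable (borel_dual R)"
proof -
  let ?B = "some_basis R"
  note B = fin_subspaces_basis[OF R]
  have B_sub: "?B \<subseteq> R"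
    using span_superset[of ?B] B(3) by simp
  have [measurable]: "(\<lambda>l. l b) \<in> borel_measurable (borel_dual R)" if b: "b \<in> ?B" for b
  proof (rule borel_measurableI)
    fix S :: "real set" assume "open S"
    have "openin (powertop_real ?B) {f \<in> topspace (powertop_real ?B). f b \<in> S}"
      using b \<open>open S\<close>
      by (intro openin_continuous_map_preimage[OF continuous_map_product_projection]) auto
    moreover have "(\<lambda>l. l b) -` S \<inter> alg_dual R =
        (\<lambda>l. restrict l ?B) -` {f \<in> topspace (powertop_real ?B). f b \<in> S} \<inter> alg_dual R"
      using b by auto
    ultimately have "openin (euclid_top_dual R) ((\<lambda>l. l b) -` S \<inter> alg_dual R)"
      unfolding euclid_top_dual_def openin_pullback_topology by blast
    then show "(\<lambda>l. l b) -` S \<inter> space (borel_dual R) \<in> sets (borel_dual R)"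
      by (auto simp: space_borel_dual sets_borel_dual)
  qed
  have "\<xi> = (\<Sum>b\<in>?B. representation ?B \<xi> b *\<^sub>R b)"
    using sum_representation_eq[OF B(2), of \<xi> ?B] B assms(2) by simp
  then have "l \<xi> = (\<Sum>b\<in>?B. representation ?B \<xi> b * l b)" if "l \<in> alg_dual R" for l
    using alg_dual_sum[OF that fin_subspaces_subspace[OF R] B(1) B_sub] by metis
  then show ?thesis
    by (subst measurable_cong[where g="\<lambda>l. \<Sum>b\<in>?B. representation ?B \<xi> b * l b"])
       (auto simp: space_borel_dual)
qed

lemma sets_borel_dual_eq_eval_algebra:
  assumes R: "R \<in> fin_subspaces"
  shows "sets (borel_dual R) = sets (eval_algebra R)"
proof (intro equalityI)
  show "sets (borel_dual R) \<subseteq> sets (eval_algebra R)"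
    unfolding sets_borel_dual using openin_euclid_top_dual_eval_algebra[OF R]
    by (metis (no_types, lifting) mem_Collect_eq sets.sigma_sets_subset space_eval_algebra subsetI)
  have "(\<lambda>l. l \<xi>) -` B \<inter> alg_dual R \<in> sets (borel_dual R)" if "\<xi> \<in> R" "B \<in> sets borel" for \<xi> B
    using measurable_sets[OF measurable_eval_borel_dual[OF R that(1)] that(2)]
    by (simp add: space_borel_dual)
  then have "sigma_sets (space (borel_dual R))
      {(\<lambda>l. l \<xi>) -` B \<inter> alg_dual R | \<xi> B. \<xi> \<in> R \<and> B \<in> sets borel} \<subseteq> sets (borel_dual R)"
    by (intro sets.sigma_sets_subset) auto
  then show "sets (eval_algebra R) \<subseteq> sets (borel_dual R)"
    by (simp add: sets_eval_algebra space_borel_dual)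
qed

lemma corresponding_measure_cong_sets:
  "sets A = sets B \<Longrightarrow> corresponding_measure A V chi M = corresponding_measure B V chi M"
  by (simp add: corresponding_measure_def)

lemma corresponding_measure_space:
  "corresponding_measure (eval_algebra V) V chi M \<Longrightarrow> space M = alg_dual V"
  using sets_eq_imp_space_eq[of M "eval_algebra V"]
  by (simp add: corresponding_measure_def space_eval_algebra)

text \<open>The total mass is the value of the characteristic function at \<open>0\<close>.\<close>
lemma corresponding_measure_prob_space:
  assumes M: "corresponding_measure (eval_algebra V) V chi M" and "0 \<in> V" "chi 0 = 1"
  shows "prob_space M"
proof -
  have "has_bochner_integral M (\<lambda>l. exp (\<i> * complex_of_real (l 0))) 1"
    using assms by (auto simp: corresponding_measure_def)
  moreover have "iexp (l 0) = 1" if "l \<in> space M" for l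
  proof -
    have "l 0 = 0"
      using that corresponding_measure_space[OF M] alg_dual_zero[OF _ \<open>0 \<in> V\<close>] by blast
    then show ?thesis
      by simp
  qed
  ultimately have "has_bochner_integral M (\<lambda>l. 1 :: complex) 1"
    by (subst (asm) has_bochner_integral_cong[OF refl _ refl, where g="\<lambda>l. 1"])
  then have int: "integrable M (\<lambda>l. 1 :: complex)" "(\<integral>l. (1::complex) \<partial>M) = 1"
    by (auto simp: has_bochner_integral_iff)
  then have "emeasure M (space M) \<noteq> \<infinity>"
    using integrable_iff_bounded[of M "\<lambda>l. 1::complex"] by (auto simp: less_top)
  moreover have "measure M (space M) = 1"
    using int(2) by (simp add: scaleR_conv_of_real)
  ultimately show ?thesis
    by (intro prob_spaceI) (simp add: emeasure_eq_ennreal_measure)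
qed

text \<open>
  Linearity of the functionals turns \<open>\<Sum>b\<in>B. r b * l b\<close> into the evaluation at \<open>\<Sum>b\<in>B. r b *\<^sub>R b\<close>. So
  \<open>chi\<close> prescribes the joint characteristic function of any finitely many evaluations, and thereby
  the measure of the rectangles, a generating \<open>\<pi>\<close>-system.
\<close>
lemma corresponding_measure_unique:
  assumes V: "subspace V" and chi0: "chi 0 = 1"
    and M: "corresponding_measure (eval_algebra V) V chi M"
    and N: "corresponding_measure (eval_algebra V) V chi N"
  shows "M = N"
proof -
  have "0 \<in> V"
    using V by (rule subspace_0)
  interpret M: prob_space M
    by (rule corresponding_measure_prob_space[of V chi]) fact+
  interpret N: prob_space N
    by (rule corresponding_measure_prob_space[of V chi]) fact+
  note space = corresponding_measure_space[OF M] corresponding_measure_space[OF N]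
  have sets: "sets M = sets (eval_algebra V)" "sets N = sets (eval_algebra V)"
    using M N by (auto simp: corresponding_measure_def)
  define rects where
    "rects = {{l \<in> alg_dual V. \<forall>\<xi>\<in>B. l \<xi> \<in> A \<xi>} | B A. finite B \<and> B \<subseteq> V \<and> (\<forall>\<xi>. A \<xi> \<in> sets borel)}"
  have rectsI: "{l \<in> alg_dual V. \<forall>\<xi>\<in>B. l \<xi> \<in> A \<xi>} \<in> rects"
    if "finite B" "B \<subseteq> V" "\<And>\<xi>. A \<xi> \<in> sets borel" for B A
    using that unfolding rects_def mem_Collect_eq by (intro exI[of _ B] exI[of _ A]) simp
  have rectsE: thesis if "C \<in> rects"
      "\<And>B A. C = {l \<in> alg_dual V. \<forall>\<xi>\<in>B. l \<xi> \<in> A \<xi>} \<Longrightarrow> finite B \<Longrightarrow> B \<subseteq> V \<Longrightarrow>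
        (\<forall>\<xi>. A \<xi> \<in> sets borel) \<Longrightarrow> thesis" for C thesis
    using that(1) unfolding rects_def mem_Collect_eq by (elim exE conjE) (rule that(2))
  have eval: "(\<lambda>l. l \<xi>) \<in> borel_measurable M" if "\<xi> \<in> V" for \<xi>
    using measurable_eval[OF that] sets by (simp cong: measurable_cong_sets)
  have Int_stable: "Int_stable rects"
  proof (rule Int_stableI)
    fix a b assume "a \<in> rects" "b \<in> rects"
    obtain B A where
      a: "a = {l \<in> alg_dual V. \<forall>\<xi>\<in>B. l \<xi> \<in> A \<xi>}" "finite B" "B \<subseteq> V" "\<forall>\<xi>. A \<xi> \<in> sets borel"
      using \<open>a \<in> rects\<close> by (rule rectsE)
    obtain B' A' where
      b: "b = {l \<in> alg_dual V. \<forall>\<xi>\<in>B'. l \<xi> \<in> A' \<xi>}" "finite B'" "B' \<subseteq> V" "\<forall>\<xi>. A' \<xi> \<in> sets borel"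
      using \<open>b \<in> rects\<close> by (rule rectsE)
    let ?A = "\<lambda>\<xi>. (if \<xi> \<in> B then A \<xi> else UNIV) \<inter> (if \<xi> \<in> B' then A' \<xi> else UNIV)"
    have "a \<inter> b = {l \<in> alg_dual V. \<forall>\<xi>\<in>B \<union> B'. l \<xi> \<in> ?A \<xi>}"
      unfolding a(1) b(1) by auto
    also have "\<dots> \<in> rects"
      using a b by (intro rectsI) auto
    finally show "a \<inter> b \<in> rects" .
  qed
  have rects_sets: "rects \<subseteq> sets M"
  proof
    fix C assume "C \<in> rects"
    then obtain B A where C: "C = {l \<in> alg_dual V. \<forall>\<xi>\<in>B. l \<xi> \<in> A \<xi>}" "finite B" "B \<subseteq> V"
      "\<forall>\<xi>. A \<xi> \<in> sets borel"
      by (rule rectsE)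
    then have [measurable]: "\<And>b. b \<in> B \<Longrightarrow> (\<lambda>l. l b) \<in> borel_measurable M" "\<And>b. A b \<in> sets borel"
      using eval by auto
    have "{l \<in> space M. \<forall>\<xi>\<in>B. l \<xi> \<in> A \<xi>} \<in> sets M"
      using \<open>finite B\<close> by measurable
    then show "C \<in> sets M"
      by (simp add: C space)
  qed
  have gen: "sets (eval_algebra V) = sigma_sets (alg_dual V) rects"
  proof (intro equalityI)
    have "(\<lambda>l. l \<xi>) -` B \<inter> alg_dual V \<in> rects" if "\<xi> \<in> V" "B \<in> sets borel" for \<xi> B
    proof -
      have "(\<lambda>l. l \<xi>) -` B \<inter> alg_dual V = {l \<in> alg_dual V. \<forall>\<eta>\<in>{\<xi>}. l \<eta> \<in> B}"
        by auto
      also have "\<dots> \<in> rects"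
        using that by (intro rectsI) auto
      finally show ?thesis .
    qed
    then show "sets (eval_algebra V) \<subseteq> sigma_sets (alg_dual V) rects"
      unfolding sets_eval_algebra by (intro sigma_sets_mono') auto
    show "sigma_sets (alg_dual V) rects \<subseteq> sets (eval_algebra V)"
      using sets.sigma_sets_subset[OF rects_sets] by (simp add: space sets)
  qed
  show ?thesis
  proof (rule measure_eqI_generator_eq[where E=rects and \<Omega>="alg_dual V" and A="\<lambda>_. alg_dual V"])
    fix C assume "C \<in> rects"
    then obtain B A where C: "C = {l \<in> alg_dual V. \<forall>\<xi>\<in>B. l \<xi> \<in> A \<xi>}" and B: "finite B" "B \<subseteq> V"
      and A: "\<forall>\<xi>. A \<xi> \<in> sets borel"
      by (rule rectsE)
    have "(\<integral>l. iexp (\<Sum>b\<in>B. r b * l b) \<partial>K) = chi (\<Sum>b\<in>B. r b *\<^sub>R b)"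
      if K: "corresponding_measure (eval_algebra V) V chi K" for K r
    proof -
      have "(\<Sum>b\<in>B. r b *\<^sub>R b) \<in> V"
        using B V by (auto intro!: subspace_sum subspace_scale)
      then have "(\<integral>l. iexp (l (\<Sum>b\<in>B. r b *\<^sub>R b)) \<partial>K) = chi (\<Sum>b\<in>B. r b *\<^sub>R b)"
        using K by (auto simp: corresponding_measure_def has_bochner_integral_iff)
      moreover have "(\<integral>l. iexp (l (\<Sum>b\<in>B. r b *\<^sub>R b)) \<partial>K) = (\<integral>l. iexp (\<Sum>b\<in>B. r b * l b) \<partial>K)"
        using corresponding_measure_space[OF K]
        by (intro Bochner_Integration.integral_cong) (simp_all only: alg_dual_sum[OF _ V B])
      ultimately show ?thesis
        by simp
    qed
    note this[OF M] this[OF N]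
    then have "measure M {l\<in>space M. \<forall>b\<in>B. l b \<in> A b} = measure N {l\<in>space M. \<forall>b\<in>B. l b \<in> A b}"
      using sets A B eval
      by (intro rectangles_determined_by_characters[where X="\<lambda>b l. l b"] M.finite_measure_axioms N.finite_measure_axioms) auto
    then show "emeasure M C = emeasure N C"
      by (simp add: C space M.emeasure_eq_measure N.emeasure_eq_measure)
  next
    show "range (\<lambda>_. alg_dual V) \<subseteq> rects"
      using rectsI[of "{}" "\<lambda>_. UNIV"] by auto
  qed (use Int_stable rects_sets sets gen sets.space_closed[of M] in \<open>auto simp: space\<close>)
qed

lemma corresponding_measure_distr:
  assumes N: "f \<in> measurable N (eval_algebra V)"
    and chi: "\<And>\<xi>. \<xi> \<in> V \<Longrightarrow> has_bochner_integral N (\<lambda>x. iexp (f x \<xi>)) (chi \<xi>)"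
    and M: "sets M = sets (eval_algebra V)"
  shows "corresponding_measure (eval_algebra V) V chi (distr N M f)"
  unfolding corresponding_measure_def
proof (intro conjI ballI)
  have [measurable]: "f \<in> measurable N M"
    using N M by (simp cong: measurable_cong_sets)
  fix \<xi> assume "\<xi> \<in> V"
  then have [measurable]: "(\<lambda>l. l \<xi>) \<in> borel_measurable M"
    using measurable_eval M by (simp cong: measurable_cong_sets)
  show "has_bochner_integral (distr N M f) (\<lambda>l. iexp (l \<xi>)) (chi \<xi>)"
    using chi[OF \<open>\<xi> \<in> V\<close>]
    by (auto simp: has_bochner_integral_iff integrable_distr_eq integral_distr)
qed (simp add: M)

text \<open>The criterion by which all maps into dual spaces below are seen to be measure preserving.\<close>
lemma mpres_into_corresponding_measure:
  assumes V: "subspace V" and chi0: "chi 0 = 1"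
    and M: "corresponding_measure (eval_algebra V) V chi M"
    and f: "f \<in> measurable N (eval_algebra V)"
    and chi: "\<And>\<xi>. \<xi> \<in> V \<Longrightarrow> has_bochner_integral N (\<lambda>x. iexp (f x \<xi>)) (chi \<xi>)"
  shows "mpres N M f"
proof -
  have sets: "sets M = sets (eval_algebra V)"
    using M by (simp add: corresponding_measure_def)
  then have "f \<in> measurable N M"
    using f by (simp cong: measurable_cong_sets)
  moreover have "distr N M f = M"
    by (rule corresponding_measure_unique[OF V chi0 corresponding_measure_distr[OF f chi sets] M])
  ultimately show ?thesis
    by (simp add: mpres_def)
qed

lemma mpres_restrict:
  assumes W: "subspace W" "W \<subseteq> V" and chi0: "chi 0 = 1"
    and M: "corresponding_measure (eval_algebra V) V chi M"
    and N: "corresponding_measure (eval_algebra W) W chi N"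
  shows "mpres M N (\<lambda>l. restrict l W)"
proof (rule mpres_into_corresponding_measure[OF W(1) chi0 N])
  show "(\<lambda>l. restrict l W) \<in> measurable M (eval_algebra W)"
    using measurable_restrict_eval_algebra[OF W] M
    by (simp add: corresponding_measure_def cong: measurable_cong_sets)
qed (use M W in \<open>auto simp: corresponding_measure_def\<close>)


section \<open>The limit of the finite dimensional marginals\<close>

text \<open>
  The structure maps of a cone combine to a map into the set-theoretic projective limit; the image
  measure has the required marginals.
\<close>
lemma prob_cone_imp_convergent_diagram:
  assumes cone: "prob_cone I M \<pi> L \<phi>"
  shows "convergent_diagram I M \<pi>"
proof -
  let ?S = "set_proj_limit I M \<pi>"
  let ?G = "{(\<lambda>l. l R) -` A \<inter> ?S | R A. R \<in> I \<and> A \<in> sets (M R)}"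
  have phi: "\<phi> R \<in> measurable L (M R)" "distr L (M R) (\<phi> R) = M R" if "R \<in> I" for R
    using cone that by (auto simp: prob_cone_def mpres_def)
  have space: "space (sigma ?S ?G) = ?S" and sets: "sets (sigma ?S ?G) = sigma_sets ?S ?G"
    by (rule space_measure_of sets_measure_of; auto)+
  have compat: "\<phi> R x = \<pi> R F (\<phi> F x)" if "R \<in> I" "F \<in> I" "R \<le> F" "x \<in> space L" for R F x
    using cone that unfolding prob_cone_def by blast
  define f where "f x = (\<lambda>R\<in>I. \<phi> R x)" for x
  have f_S: "f x \<in> ?S" if "x \<in> space L" for x
    using that measurable_space[OF phi(1)]
    by (auto simp: set_proj_limit_def f_def compat[symmetric])
  have f: "f \<in> measurable L (sigma ?S ?G)"
  proof (rule measurable_measure_of)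
    fix B assume "B \<in> ?G"
    then obtain R A where B: "B = (\<lambda>l. l R) -` A \<inter> ?S" "R \<in> I" "A \<in> sets (M R)"
      by blast
    then have "f -` B \<inter> space L = \<phi> R -` A \<inter> space L"
      using f_S by (auto simp: f_def)
    then show "f -` B \<inter> space L \<in> sets L"
      using phi(1)[OF B(2)] B(3) by (simp add: measurable_sets)
  qed (use f_S in auto)
  show ?thesis
    unfolding convergent_diagram_def
  proof (intro exI[of _ "distr L (sigma ?S ?G) f"] conjI ballI)
    fix R assume R: "R \<in> I"
    have "(\<lambda>l. l R) \<in> measurable (sigma ?S ?G) (M R)"
    proof (rule measurableI)
      show "l R \<in> space (M R)" if "l \<in> space (sigma ?S ?G)" for l
        using that R unfolding space by (auto simp: set_proj_limit_def)
      show "(\<lambda>l. l R) -` A \<inter> space (sigma ?S ?G) \<in> sets (sigma ?S ?G)" if "A \<in> sets (M R)" for A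
        unfolding space sets using that R by (intro sigma_sets.Basic) blast
    qed
    then have "distr (distr L (sigma ?S ?G) f) (M R) (\<lambda>l. l R) = distr L (M R) (\<lambda>x. f x R)"
      using f by (subst distr_distr) (auto simp: comp_def)
    also have "\<dots> = M R"
      using R phi(2)[OF R] by (simp add: f_def)
    finally show "distr (distr L (sigma ?S ?G) f) (M R) (\<lambda>l. l R) = M R" .
  qed simp
qed

lemma prob_diagram_finite_dim_marginals:
  assumes chi0: "chi 0 = 1"
    and \<mu>R: "\<And>R. R \<in> fin_subspaces \<Longrightarrow> corresponding_measure (eval_algebra R) R chi (\<mu>R R)"
  shows "prob_diagram fin_subspaces \<mu>R (\<lambda>R F l. restrict l R)"
  unfolding prob_diagram_def
proof (intro conjI ballI impI)
  fix R :: "'a set" assume R: "R \<in> fin_subspaces"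
  show "prob_space (\<mu>R R)"
    using corresponding_measure_prob_space[of R chi "\<mu>R R"] \<mu>R[OF R] chi0
      subspace_0[OF fin_subspaces_subspace[OF R]] by blast
  show "restrict l R = l" if "l \<in> space (\<mu>R R)" for l
    using that corresponding_measure_space[OF \<mu>R[OF R]] by (simp add: restrict_alg_dual_self)
  fix F assume F: "F \<in> fin_subspaces" "R \<le> F"
  show "mpres (\<mu>R F) (\<mu>R R) (\<lambda>l. restrict l R)"
    by (rule mpres_restrict[OF fin_subspaces_subspace[OF R] F(2) chi0 \<mu>R[OF F(1)] \<mu>R[OF R]])
  show "restrict l R = restrict (restrict l F) R" for l :: "'a \<Rightarrow> real"
    using F(2) by (simp add: Int_absorb1)
qed

lemma prob_cone_dual:
  assumes chi0: "chi 0 = 1"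
    and \<mu>: "corresponding_measure (eval_algebra UNIV) UNIV chi \<mu>"
    and \<mu>R: "\<And>R. R \<in> fin_subspaces \<Longrightarrow> corresponding_measure (eval_algebra R) R chi (\<mu>R R)"
  shows "prob_cone fin_subspaces \<mu>R (\<lambda>R F l. restrict l R) \<mu> (\<lambda>R l. restrict l R)"
  unfolding prob_cone_def
proof (intro conjI ballI impI)
  show "prob_space \<mu>"
    using corresponding_measure_prob_space[OF \<mu>] chi0 by simp
  fix R :: "'a set" assume R: "R \<in> fin_subspaces"
  show "mpres \<mu> (\<mu>R R) (\<lambda>l. restrict l R)"
    by (rule mpres_restrict[OF fin_subspaces_subspace[OF R] _ chi0 \<mu> \<mu>R[OF R]]) simp
  fix F assume "R \<le> F"
  then show "restrict l R = restrict (restrict l F) R" for l :: "'a \<Rightarrow> real"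
    by (simp add: Int_absorb1)
qed

text \<open>
  The functional assigned to a point \<open>x\<close> of a competing cone is forced at each vector by the line
  that the vector spans. It is linear because for two vectors the cone also provides a functional
  on the plane that they span.
\<close>
lemma prob_limit_dual:
  fixes chi :: "'a::real_vector \<Rightarrow> complex"
  assumes chi0: "chi 0 = 1"
    and \<mu>: "corresponding_measure (eval_algebra UNIV) UNIV chi \<mu>"
    and \<mu>R: "\<And>R. R \<in> fin_subspaces \<Longrightarrow> corresponding_measure (eval_algebra R) R chi (\<mu>R R)"
  shows "prob_limit TYPE('b) fin_subspaces \<mu>R (\<lambda>R F l. restrict l R) \<mu> (\<lambda>R l. restrict l R)"
  unfolding prob_limit_def
proof (intro conjI allI impI)
  show "prob_cone fin_subspaces \<mu>R (\<lambda>R F l. restrict l R) \<mu> (\<lambda>R l. restrict l R)"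
    by (rule prob_cone_dual[OF chi0 \<mu> \<mu>R])
  fix N :: "'b measure" and \<psi>
  assume cone: "prob_cone fin_subspaces \<mu>R (\<lambda>R F l. restrict l R) N \<psi>"
  have psi: "\<psi> R \<in> measurable N (\<mu>R R)" "distr N (\<mu>R R) (\<psi> R) = \<mu>R R" if "R \<in> fin_subspaces" for R
    using cone that by (auto simp: prob_cone_def mpres_def)
  have psi_dual: "\<psi> R x \<in> alg_dual R" if "R \<in> fin_subspaces" "x \<in> space N" for R x
    using measurable_space[OF psi(1)[OF that(1)] that(2)] corresponding_measure_space[OF \<mu>R[OF that(1)]]
    by simp
  have compat: "\<psi> R x = restrict (\<psi> F x) R"
    if "R \<in> fin_subspaces" "F \<in> fin_subspaces" "R \<le> F" "x \<in> space N" for R F x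
    using cone that unfolding prob_cone_def by blast
  have line: "span {\<xi>} \<in> fin_subspaces" "\<xi> \<in> span {\<xi>}" for \<xi> :: 'a
    by (auto intro: span_in_fin_subspaces span_base)
  define f where "f = (\<lambda>x\<in>space N. \<lambda>\<xi>. \<psi> (span {\<xi>}) x \<xi>)"
  have f_eq: "f x \<xi> = \<psi> R x \<xi>" if "R \<in> fin_subspaces" "\<xi> \<in> R" "x \<in> space N" for R \<xi> x
  proof -
    have "span {\<xi>} \<le> R"
      using that fin_subspaces_subspace by (intro span_minimal) auto
    then have "\<psi> (span {\<xi>}) x = restrict (\<psi> R x) (span {\<xi>})"
      using that line by (intro compat) auto
    then have "\<psi> (span {\<xi>}) x \<xi> = \<psi> R x \<xi>"
      using line(2)[of \<xi>] by (metis restrict_apply')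
    then show ?thesis
      using that(3) by (simp add: f_def)
  qed
  have f_dual: "f x \<in> alg_dual UNIV" if x: "x \<in> space N" for x
    unfolding alg_dual_def
  proof (intro CollectI conjI ballI allI)
    fix \<xi> \<eta> :: 'a and c :: real
    have R: "span {\<xi>, \<eta>} \<in> fin_subspaces"
      by (simp add: span_in_fin_subspaces)
    have "\<xi> \<in> span {\<xi>, \<eta>}" "\<eta> \<in> span {\<xi>, \<eta>}" "\<xi> + \<eta> \<in> span {\<xi>, \<eta>}" "c *\<^sub>R \<xi> \<in> span {\<xi>, \<eta>}"
      by (auto intro: span_add span_scale span_base)
    then show "f x (\<xi> + \<eta>) = f x \<xi> + f x \<eta>" "f x (c *\<^sub>R \<xi>) = c * f x \<xi>"
      using psi_dual[OF R x] by (simp_all add: f_eq[OF R _ x] alg_dual_def)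
  qed simp
  have eval_psi: "(\<lambda>l. l \<xi>) \<in> borel_measurable (\<mu>R R)" if "R \<in> fin_subspaces" "\<xi> \<in> R" for R \<xi>
    using measurable_eval[OF that(2)] \<mu>R[OF that(1)]
    by (simp add: corresponding_measure_def cong: measurable_cong_sets)
  have f_meas: "f \<in> measurable N (eval_algebra UNIV)"
  proof (rule measurable_into_eval_algebra)
    fix \<xi> :: 'a
    have "(\<lambda>x. \<psi> (span {\<xi>}) x \<xi>) \<in> borel_measurable N"
      using measurable_compose[OF psi(1)[OF line(1)] eval_psi[OF line]] .
    then show "(\<lambda>x. f x \<xi>) \<in> borel_measurable N"
      by (rule measurable_cong[THEN iffD1, rotated]) (simp add: f_def)
  qed (use f_dual in auto)
  have f_chi: "has_bochner_integral N (\<lambda>x. iexp (f x \<xi>)) (chi \<xi>)" for \<xi>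
  proof -
    let ?R = "span {\<xi>}"
    have [measurable]: "\<psi> ?R \<in> measurable N (\<mu>R ?R)" "(\<lambda>l. l \<xi>) \<in> borel_measurable (\<mu>R ?R)"
      using psi(1) eval_psi line by auto
    have "has_bochner_integral (distr N (\<mu>R ?R) (\<psi> ?R)) (\<lambda>l. iexp (l \<xi>)) (chi \<xi>)"
      using \<mu>R[OF line(1)] psi(2)[OF line(1)] line(2)[of \<xi>] by (simp add: corresponding_measure_def)
    then have "has_bochner_integral N (\<lambda>x. iexp (\<psi> ?R x \<xi>)) (chi \<xi>)"
      by (simp add: has_bochner_integral_iff integrable_distr_eq integral_distr)
    then show ?thesis
      by (subst has_bochner_integral_cong[OF refl _ refl, where g="\<lambda>x. iexp (\<psi> ?R x \<xi>)"]) (simp_all add: f_def)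
  qed
  show "\<exists>!f. f \<in> extensional (space N) \<and> mpres N \<mu> f \<and>
      (\<forall>R\<in>fin_subspaces. \<forall>x\<in>space N. restrict (f x) R = \<psi> R x)"
  proof (intro ex1I[of _ f] conjI ballI)
    show "f \<in> extensional (space N)"
      by (simp add: f_def)
    show "mpres N \<mu> f"
      by (rule mpres_into_corresponding_measure[OF subspace_UNIV chi0 \<mu> f_meas f_chi])
    show "restrict (f x) R = \<psi> R x" if R: "R \<in> fin_subspaces" and x: "x \<in> space N" for R x
      using psi_dual[OF R x] f_eq[OF R _ x]
      by (auto simp: alg_dual_def extensional_def restrict_def fun_eq_iff)
  next
    fix g assume g: "g \<in> extensional (space N) \<and> mpres N \<mu> g \<and>
      (\<forall>R\<in>fin_subspaces. \<forall>x\<in>space N. restrict (g x) R = \<psi> R x)"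
    have "g x \<xi> = f x \<xi>" if x: "x \<in> space N" for x \<xi>
    proof -
      have "restrict (g x) (span {\<xi>}) \<xi> = \<psi> (span {\<xi>}) x \<xi>"
        using g x line(1)[of \<xi>] by simp
      then show ?thesis
        using line(2)[of \<xi>] x by (simp add: f_def)
    qed
    then show "g = f"
      using g by (intro extensionalityI[of _ "space N"]) (auto simp: f_def)
  qed
qed


section \<open>Colimits of Banach spaces along directed sets\<close>

context real_banach
begin

lemma scale_zero: "vscale V (-1) (vzero V) = vzero V"
  using add_neg[OF zero_closed] add_zero[OF scale_closed[OF zero_closed]]
    add_commute[OF zero_closed scale_closed[OF zero_closed]] by metis

lemma vdist_zero: "x \<in> vecs V \<Longrightarrow> vdist V x (vzero V) = vnorm V x"
  by (simp add: vdist_def scale_zero add_zero)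

lemma vdist_nonneg: "x \<in> vecs V \<Longrightarrow> y \<in> vecs V \<Longrightarrow> 0 \<le> vdist V x y"
  by (simp add: vdist_def norm_nonneg add_closed scale_closed)

lemma vdist_commute:
  assumes x: "x \<in> vecs V" and y: "y \<in> vecs V"
  shows "vdist V x y = vdist V y x"
proof -
  have "vadd V y (vscale V (-1) x) = vscale V (-1) (vadd V x (vscale V (-1) y))"
    using x y by (simp add: scale_add scale_scale scale_one scale_closed add_commute)
  then show ?thesis
    using norm_scale[of "vadd V x (vscale V (-1) y)" "-1"] x y
    by (simp add: vdist_def add_closed scale_closed)
qed

lemma vdist_triangle:
  assumes x: "x \<in> vecs V" and y: "y \<in> vecs V" and z: "z \<in> vecs V"
  shows "vdist V x z \<le> vdist V x y + vdist V y z"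
proof -
  let ?m = "vscale V (-1)"
  note cl = x y z scale_closed add_closed zero_closed
  have "vadd V (vadd V x (?m y)) (vadd V y (?m z)) = vadd V x (vadd V (vadd V (?m y) y) (?m z))"
    using cl by (simp add: add_assoc)
  also have "vadd V (?m y) y = vzero V"
    using cl by (subst add_commute) (simp_all add: add_neg)
  also have "vadd V (vzero V) (?m z) = ?m z"
    using cl by (subst add_commute) (simp_all add: add_zero)
  finally have "vadd V x (?m z) = vadd V (vadd V x (?m y)) (vadd V y (?m z))" ..
  then show ?thesis
    unfolding vdist_def using cl by (simp add: norm_triangle)
qed

lemma eq_of_vdist_small:
  assumes x: "x \<in> vecs V" and y: "y \<in> vecs V" and small: "\<And>e. 0 < e \<Longrightarrow> vdist V x y \<le> e"
  shows "x = y"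
proof -
  let ?m = "vscale V (-1)"
  note cl = x y scale_closed add_closed zero_closed
  have "vdist V x y = 0"
    using field_le_epsilon[of "vdist V x y" 0] small vdist_nonneg[OF x y] by auto
  then have 0: "vadd V x (?m y) = vzero V"
    using norm_eq_zero cl by (simp add: vdist_def)
  have "x = vadd V x (vadd V (?m y) y)"
    using cl by (subst add_commute[of "?m y" y]) (simp_all add: add_neg add_zero)
  also have "\<dots> = vadd V (vzero V) y"
    using cl by (simp add: 0[symmetric] add_assoc)
  also have "\<dots> = y"
    using cl by (subst add_commute) (simp_all add: add_zero)
  finally show ?thesis .
qed

lemma vdist_reverse_triangle:
  assumes "x \<in> vecs V" "y \<in> vecs V" "z \<in> vecs V"
  shows "\<bar>vdist V x z - vdist V y z\<bar> \<le> vdist V x y"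
  using vdist_triangle[of x y z] vdist_triangle[of y x z] vdist_commute[of x y] assms by auto

lemma vdist_add:
  assumes "x \<in> vecs V" "y \<in> vecs V" "x' \<in> vecs V" "y' \<in> vecs V"
  shows "vdist V (vadd V x y) (vadd V x' y') \<le> vdist V x x' + vdist V y y'"
proof -
  let ?m = "vscale V (-1)"
  note cl = assms scale_closed add_closed
  have "vadd V (vadd V x y) (vadd V (?m x') (?m y')) = vadd V x (vadd V (vadd V y (?m x')) (?m y'))"
    using cl by (simp add: add_assoc)
  also have "vadd V y (?m x') = vadd V (?m x') y"
    using cl by (intro add_commute) auto
  also have "vadd V x (vadd V (vadd V (?m x') y) (?m y')) = vadd V (vadd V x (?m x')) (vadd V y (?m y'))"
    using cl by (simp add: add_assoc)
  finally show ?thesis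
    unfolding vdist_def using cl by (simp add: scale_add norm_triangle)
qed

lemma vdist_scale:
  assumes "x \<in> vecs V" "y \<in> vecs V"
  shows "vdist V (vscale V c x) (vscale V c y) = \<bar>c\<bar> * vdist V x y"
proof -
  have "vadd V (vscale V c x) (vscale V (-1) (vscale V c y)) = vscale V c (vadd V x (vscale V (-1) y))"
    using assms by (simp add: scale_add scale_scale scale_closed)
  then show ?thesis
    using assms by (simp add: vdist_def norm_scale add_closed scale_closed)
qed

end

lemma lin_isometry_closed: "lin_isometry V W f \<Longrightarrow> x \<in> vecs V \<Longrightarrow> f x \<in> vecs W"
  by (auto simp: lin_isometry_def)

lemma lin_isometry_vdist:
  assumes f: "lin_isometry V W f" and V: "real_banach V" and x: "x \<in> vecs V" "y \<in> vecs V"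
  shows "vdist W (f x) (f y) = vdist V x y"
proof -
  interpret V: real_banach V by fact
  have "vadd W (f x) (vscale W (-1) (f y)) = f (vadd V x (vscale V (-1) y))"
    using f x V.scale_closed by (simp add: lin_isometry_def)
  moreover have "vnorm W (f (vadd V x (vscale V (-1) y))) = vnorm V (vadd V x (vscale V (-1) y))"
    using f x V.scale_closed V.add_closed unfolding lin_isometry_def by blast
  ultimately show ?thesis
    by (simp add: vdist_def)
qed

lemma lin_isometry_zero:
  assumes f: "lin_isometry V W f" and V: "real_banach V" and W: "real_banach W"
  shows "f (vzero V) = vzero W"
proof -
  interpret V: real_banach V by fact
  interpret W: real_banach W by fact
  have "vnorm W (f (vzero V)) = 0"
    using f V.zero_closed V.norm_eq_zero by (simp add: lin_isometry_def)
  then show ?thesis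
    using lin_isometry_closed[OF f V.zero_closed] W.norm_eq_zero by blast
qed

text \<open>
  Extension by density. Instead of choosing approximating sequences, the image of \<open>y\<close> is
  characterized as the point of \<open>Y'\<close> that has the same distances to all \<open>\<rho> R z\<close> as \<open>y\<close> has to
  the corresponding \<open>\<psi> R z\<close>. By density there is at most one such point, and by completeness of
  \<open>Y'\<close> there is one. Every isometry that is compatible with the cocones sends \<open>y\<close> to a point
  with this property, which yields uniqueness.
\<close>
lemma ban_colimit_of_dense_union:
  assumes codiag: "ban_codiagram I Z \<phi>" and Y: "ban_cocone I Z \<phi> Y \<psi>"
    and directed: "\<And>R F. R \<in> I \<Longrightarrow> F \<in> I \<Longrightarrow> \<exists>T\<in>I. R \<le> T \<and> F \<le> T"
    and dense: "\<And>y e. y \<in> vecs Y \<Longrightarrow> 0 < e \<Longrightarrow> \<exists>R\<in>I. \<exists>z\<in>vecs (Z R). vdist Y y (\<psi> R z) < e"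
  shows "ban_colimit TYPE('c) I Z \<phi> Y \<psi>"
  unfolding ban_colimit_def
proof (intro conjI allI impI)
  show "ban_cocone I Z \<phi> Y \<psi>" by fact
  fix Y' :: "'c nspace" and \<rho> assume Y': "ban_cocone I Z \<phi> Y' \<rho>"
  have Z_banach: "real_banach (Z R)" if "R \<in> I" for R
    using codiag that by (simp add: ban_codiagram_def)
  have phi: "lin_isometry (Z R) (Z F) (\<phi> R F)" if "R \<in> I" "F \<in> I" "R \<le> F" for R F
    using codiag that by (simp add: ban_codiagram_def)
  interpret Y: real_banach Y using Y by (simp add: ban_cocone_def)
  interpret Y': real_banach Y' using Y' by (simp add: ban_cocone_def)
  have psi: "lin_isometry (Z R) Y (\<psi> R)" and rho: "lin_isometry (Z R) Y' (\<rho> R)" if "R \<in> I" for R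
    using Y Y' that by (auto simp: ban_cocone_def)
  note closed = lin_isometry_closed[OF psi] lin_isometry_closed[OF rho]
  have compat: "\<psi> R z = \<psi> T (\<phi> R T z)" "\<rho> R z = \<rho> T (\<phi> R T z)"
    if "R \<in> I" "T \<in> I" "R \<le> T" "z \<in> vecs (Z R)" for R T z
    using Y Y' that unfolding ban_cocone_def by blast+
  \<comment> \<open>Directedness lets any two vectors of the codiagram be compared inside one of its spaces.\<close>
  have common: "\<exists>T\<in>I. \<exists>z'\<in>vecs (Z T). \<exists>w'\<in>vecs (Z T).
      \<psi> R z = \<psi> T z' \<and> \<psi> F w = \<psi> T w' \<and> \<rho> R z = \<rho> T z' \<and> \<rho> F w = \<rho> T w'"
    if RF: "R \<in> I" "F \<in> I" "z \<in> vecs (Z R)" "w \<in> vecs (Z F)" for R F z w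
  proof -
    obtain T where T: "T \<in> I" "R \<le> T" "F \<le> T"
      using directed[OF RF(1,2)] by blast
    have "\<phi> R T z \<in> vecs (Z T)" "\<phi> F T w \<in> vecs (Z T)"
      using lin_isometry_closed[OF phi] T RF by blast+
    then show ?thesis
      using T(1) compat[OF RF(1) T(1,2) RF(3)] compat[OF RF(2) T(1,3) RF(4)] by blast
  qed
  have transport: "vdist Y' (\<rho> R z) (\<rho> F w) = vdist Y (\<psi> R z) (\<psi> F w)"
    if RF: "R \<in> I" "F \<in> I" "z \<in> vecs (Z R)" "w \<in> vecs (Z F)" for R F z w
  proof -
    obtain T z' w' where T: "T \<in> I" "z' \<in> vecs (Z T)" "w' \<in> vecs (Z T)"
      and eqs: "\<psi> R z = \<psi> T z'" "\<psi> F w = \<psi> T w'" "\<rho> R z = \<rho> T z'" "\<rho> F w = \<rho> T w'"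
      using common[OF RF] by blast
    show ?thesis
      unfolding eqs using T
      by (simp add: lin_isometry_vdist[OF psi Z_banach] lin_isometry_vdist[OF rho Z_banach])
  qed
  define same_position where "same_position y y' \<longleftrightarrow> y' \<in> vecs Y' \<and>
      (\<forall>R\<in>I. \<forall>z\<in>vecs (Z R). vdist Y' y' (\<rho> R z) = vdist Y y (\<psi> R z))" for y y'
  have same_positionD1: "y' \<in> vecs Y'" if "same_position y y'" for y y'
    using that by (simp add: same_position_def)
  have same_positionD2: "vdist Y' y' (\<rho> R z) = vdist Y y (\<psi> R z)"
    if "same_position y y'" "R \<in> I" "z \<in> vecs (Z R)" for y y' R z
    using that by (simp add: same_position_def)
  have unique: "a = b" if y: "y \<in> vecs Y" and ab: "same_position y a" "same_position y b" for y a b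
  proof (rule Y'.eq_of_vdist_small)
    show a: "a \<in> vecs Y'" and b: "b \<in> vecs Y'"
      using ab by (auto simp: same_position_def)
    fix e :: real assume "0 < e"
    then obtain R z where Rz: "R \<in> I" "z \<in> vecs (Z R)" "vdist Y y (\<psi> R z) < e / 2"
      using dense[OF y, of "e / 2"] by auto
    then have "vdist Y' a b \<le> vdist Y' a (\<rho> R z) + vdist Y' b (\<rho> R z)"
      using Y'.vdist_triangle[OF a _ b] Y'.vdist_commute[OF b] closed(2) by metis
    then show "vdist Y' a b \<le> e"
      using same_positionD2[OF ab(1)] same_positionD2[OF ab(2)] Rz by auto
  qed
  have exists: "\<exists>y'. same_position y y'" if y: "y \<in> vecs Y" for y
  proof -
    have "\<forall>n::nat. \<exists>R z. R \<in> I \<and> z \<in> vecs (Z R) \<and> vdist Y y (\<psi> R z) < 1 / Suc n"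
      using dense[OF y] by (metis of_nat_0_less_iff zero_less_Suc zero_less_divide_1_iff)
    then obtain R z where Rz: "\<And>n. R n \<in> I" "\<And>n. z n \<in> vecs (Z (R n))"
        "\<And>n::nat. vdist Y y (\<psi> (R n) (z n)) < 1 / Suc n"
      by metis
    define a where "a n = \<psi> (R n) (z n)" for n
    define b where "b n = \<rho> (R n) (z n)" for n
    have a: "a n \<in> vecs Y" and b: "b n \<in> vecs Y'" for n
      using closed Rz by (auto simp: a_def b_def)
    have a_y: "vdist Y (a n) y < 1 / Suc n" for n
      using Rz(3)[of n] Y.vdist_commute[OF y a] by (simp add: a_def)
    then have a_lim: "(\<lambda>n. vdist Y (a n) y) \<longlonglongrightarrow> 0"
      using Y.vdist_nonneg[OF a y]
      by (intro tendsto_sandwich[OF _ _ tendsto_const LIMSEQ_Suc[OF lim_1_over_n]])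
         (auto intro!: always_eventually simp: less_imp_le)
    have "\<exists>y'\<in>vecs Y'. (\<lambda>n. vdist Y' (b n) y') \<longlonglongrightarrow> 0"
    proof (rule Y'.complete)
      show "\<forall>e>0. \<exists>N. \<forall>m\<ge>N. \<forall>n\<ge>N. vdist Y' (b m) (b n) < e"
      proof (intro allI impI)
        fix e :: real assume "0 < e"
        then obtain N where N: "\<And>n. n \<ge> N \<Longrightarrow> vdist Y (a n) y < e / 2"
          using order_tendstoD(2)[OF a_lim, of "e / 2"] by (auto simp: eventually_sequentially)
        have "vdist Y' (b m) (b n) < e" if "m \<ge> N" "n \<ge> N" for m n
        proof -
          have "vdist Y' (b m) (b n) = vdist Y (a m) (a n)"
            using Rz transport by (simp add: a_def b_def)
          also have "\<dots> \<le> vdist Y (a m) y + vdist Y (a n) y"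
            using Y.vdist_triangle[OF a y a] Y.vdist_commute[OF a y] by metis
          also have "\<dots> < e"
            using N[OF that(1)] N[OF that(2)] by simp
          finally show ?thesis .
        qed
        then show "\<exists>N. \<forall>m\<ge>N. \<forall>n\<ge>N. vdist Y' (b m) (b n) < e"
          by blast
      qed
    qed (use b in simp)
    then obtain y' where y': "y' \<in> vecs Y'" and b_lim: "(\<lambda>n. vdist Y' (b n) y') \<longlonglongrightarrow> 0"
      by blast
    have "vdist Y' y' (\<rho> F w) = vdist Y y (\<psi> F w)" if Fw: "F \<in> I" "w \<in> vecs (Z F)" for F w
    proof (rule LIMSEQ_unique)
      show "(\<lambda>n. vdist Y' (b n) (\<rho> F w)) \<longlonglongrightarrow> vdist Y' y' (\<rho> F w)"
      proof -
        have "(\<lambda>n. vdist Y' (b n) (\<rho> F w) - vdist Y' y' (\<rho> F w)) \<longlonglongrightarrow> 0"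
          using Y'.vdist_reverse_triangle[OF b y' closed(2)[OF Fw]]
          by (intro Lim_null_comparison[OF _ b_lim]) auto
        then show ?thesis
          by (rule LIM_zero_cancel)
      qed
      have "(\<lambda>n. vdist Y (a n) (\<psi> F w) - vdist Y y (\<psi> F w)) \<longlonglongrightarrow> 0"
        using Y.vdist_reverse_triangle[OF a y closed(1)[OF Fw]]
        by (intro Lim_null_comparison[OF _ a_lim]) auto
      moreover have "vdist Y (a n) (\<psi> F w) = vdist Y' (b n) (\<rho> F w)" for n
        using Rz Fw transport by (simp add: a_def b_def)
      ultimately show "(\<lambda>n. vdist Y' (b n) (\<rho> F w)) \<longlonglongrightarrow> vdist Y y (\<psi> F w)"
        by (simp add: LIM_zero_iff)
    qed
    then show ?thesis
      using y' by (auto simp: same_position_def)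
  qed
  define f where "f = (\<lambda>y\<in>vecs Y. THE y'. same_position y y')"
  have f_ext: "f \<in> extensional (vecs Y)"
    by (simp add: f_def)
  have f_eqI: "f y = y'" if "y \<in> vecs Y" "same_position y y'" for y y'
    using that unique by (auto simp: f_def intro!: the_equality)
  have f: "same_position y (f y)" if "y \<in> vecs Y" for y
    using exists[OF that] f_eqI[OF that] by auto
  note f_closed = same_positionD1[OF f] and f_dist = same_positionD2[OF f]
  have f_psi: "f (\<psi> R z) = \<rho> R z" if "R \<in> I" "z \<in> vecs (Z R)" for R z
    using that closed transport by (intro f_eqI) (auto simp: same_position_def)
  \<comment> \<open>The norm is the distance to \<open>0\<close>, and \<open>0\<close> is in the image of every space of the codiagram.\<close>
  obtain R0 where R0: "R0 \<in> I"
    using dense[OF Y.zero_closed, of 1] by auto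
  have f_norm: "vnorm Y' (f y) = vnorm Y y" if y: "y \<in> vecs Y" for y
  proof -
    have 0: "vzero (Z R0) \<in> vecs (Z R0)"
      using real_banach.zero_closed[OF Z_banach[OF R0]] .
    have "vdist Y' (f y) (vzero Y') = vdist Y y (vzero Y)"
      using f_dist[OF y R0 0] lin_isometry_zero[OF psi[OF R0] Z_banach[OF R0] Y.real_banach_axioms]
        lin_isometry_zero[OF rho[OF R0] Z_banach[OF R0] Y'.real_banach_axioms] by simp
    then show ?thesis
      using Y.vdist_zero[OF y] Y'.vdist_zero[OF f_closed[OF y]] by simp
  qed
  have f_add: "f (vadd Y x y) = vadd Y' (f x) (f y)" if x: "x \<in> vecs Y" and y: "y \<in> vecs Y" for x y
  proof (rule Y'.eq_of_vdist_small)
    have xy: "vadd Y x y \<in> vecs Y"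
      using x y by (rule Y.add_closed)
    then show f_xy: "f (vadd Y x y) \<in> vecs Y'"
      by (rule f_closed)
    show fx_fy: "vadd Y' (f x) (f y) \<in> vecs Y'"
      using x y by (intro Y'.add_closed f_closed)
    fix e :: real assume "0 < e"
    then obtain R z F w where "R \<in> I" "z \<in> vecs (Z R)" "F \<in> I" "w \<in> vecs (Z F)"
      and "vdist Y x (\<psi> R z) < e / 4" "vdist Y y (\<psi> F w) < e / 4"
      using dense[OF x, of "e / 4"] dense[OF y, of "e / 4"] by auto
    then obtain T u v where T: "T \<in> I" and u: "u \<in> vecs (Z T)" and v: "v \<in> vecs (Z T)"
      and small: "vdist Y x (\<psi> T u) < e / 4" "vdist Y y (\<psi> T v) < e / 4"
      using common[of R F z w] by auto
    have uv: "vadd (Z T) u v \<in> vecs (Z T)"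
      using real_banach.add_closed[OF Z_banach[OF T] u v] .
    have sum: "\<psi> T (vadd (Z T) u v) = vadd Y (\<psi> T u) (\<psi> T v)"
      "\<rho> T (vadd (Z T) u v) = vadd Y' (\<rho> T u) (\<rho> T v)"
      using psi[OF T] rho[OF T] u v by (auto simp: lin_isometry_def)
    have "vdist Y' (f (vadd Y x y)) (vadd Y' (f x) (f y))
        \<le> vdist Y' (f (vadd Y x y)) (\<rho> T (vadd (Z T) u v))
          + vdist Y' (vadd Y' (f x) (f y)) (vadd Y' (\<rho> T u) (\<rho> T v))"
      using Y'.vdist_triangle[OF f_xy closed(2)[OF T uv] fx_fy]
        Y'.vdist_commute[OF fx_fy closed(2)[OF T uv]] sum(2) by simp
    also have "\<dots> \<le> vdist Y (vadd Y x y) (vadd Y (\<psi> T u) (\<psi> T v))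
        + (vdist Y' (f x) (\<rho> T u) + vdist Y' (f y) (\<rho> T v))"
      using f_dist[OF xy T uv] sum(1)
        Y'.vdist_add[OF f_closed[OF x] f_closed[OF y] closed(2)[OF T u] closed(2)[OF T v]] by simp
    also have "\<dots> \<le> (vdist Y x (\<psi> T u) + vdist Y y (\<psi> T v)) + (vdist Y x (\<psi> T u) + vdist Y y (\<psi> T v))"
      using Y.vdist_add[OF x y closed(1)[OF T u] closed(1)[OF T v]] f_dist[OF x T u] f_dist[OF y T v]
      by simp
    also have "\<dots> \<le> e"
      using small by simp
    finally show "vdist Y' (f (vadd Y x y)) (vadd Y' (f x) (f y)) \<le> e" .
  qed
  have f_scale: "f (vscale Y c y) = vscale Y' c (f y)" if y: "y \<in> vecs Y" for c y
  proof (rule Y'.eq_of_vdist_small)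
    have cy: "vscale Y c y \<in> vecs Y"
      using y by (rule Y.scale_closed)
    then show f_cy: "f (vscale Y c y) \<in> vecs Y'"
      by (rule f_closed)
    show c_fy: "vscale Y' c (f y) \<in> vecs Y'"
      using y by (intro Y'.scale_closed f_closed)
    fix e :: real assume "0 < e"
    define d where "d = e / (2 * (\<bar>c\<bar> + 1))"
    have d: "0 < d" "2 * (\<bar>c\<bar> * d) \<le> e"
      using \<open>0 < e\<close> by (auto simp: d_def field_simps)
    obtain T u where T: "T \<in> I" and u: "u \<in> vecs (Z T)" and small: "vdist Y y (\<psi> T u) < d"
      using dense[OF y d(1)] by auto
    have cu: "vscale (Z T) c u \<in> vecs (Z T)"
      using real_banach.scale_closed[OF Z_banach[OF T] u] .
    have mult: "\<psi> T (vscale (Z T) c u) = vscale Y c (\<psi> T u)"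
      "\<rho> T (vscale (Z T) c u) = vscale Y' c (\<rho> T u)"
      using psi[OF T] rho[OF T] u by (auto simp: lin_isometry_def)
    have "vdist Y' (f (vscale Y c y)) (vscale Y' c (f y))
        \<le> vdist Y' (f (vscale Y c y)) (\<rho> T (vscale (Z T) c u))
          + vdist Y' (vscale Y' c (f y)) (vscale Y' c (\<rho> T u))"
      using Y'.vdist_triangle[OF f_cy closed(2)[OF T cu] c_fy]
        Y'.vdist_commute[OF c_fy closed(2)[OF T cu]] mult(2) by simp
    also have "\<dots> = \<bar>c\<bar> * vdist Y y (\<psi> T u) + \<bar>c\<bar> * vdist Y y (\<psi> T u)"
      using f_dist[OF cy T cu] mult(1) f_dist[OF y T u] y u T f_closed closed
      by (simp add: Y.vdist_scale Y'.vdist_scale)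
    also have "\<dots> \<le> 2 * (\<bar>c\<bar> * d)"
      using small mult_left_mono[of "vdist Y y (\<psi> T u)" d "\<bar>c\<bar>"] by simp
    finally show "vdist Y' (f (vscale Y c y)) (vscale Y' c (f y)) \<le> e"
      using d(2) by simp
  qed
  show "\<exists>!f. f \<in> extensional (vecs Y) \<and> lin_isometry Y Y' f \<and>
      (\<forall>R\<in>I. \<forall>z\<in>vecs (Z R). f (\<psi> R z) = \<rho> R z)"
  proof (intro ex1I[of _ f] conjI ballI)
    show "lin_isometry Y Y' f"
      using f_closed f_add f_scale f_norm by (simp add: lin_isometry_def)
  next
    fix g assume g: "g \<in> extensional (vecs Y) \<and> lin_isometry Y Y' g \<and>
      (\<forall>R\<in>I. \<forall>z\<in>vecs (Z R). g (\<psi> R z) = \<rho> R z)"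
    have "f y = g y" if y: "y \<in> vecs Y" for y
    proof (rule f_eqI[OF y])
      have "vdist Y' (g y) (\<rho> R z) = vdist Y y (\<psi> R z)" if "R \<in> I" "z \<in> vecs (Z R)" for R z
        using lin_isometry_vdist[of Y Y' g y "\<psi> R z"] g y that closed(1) Y.real_banach_axioms by auto
      then show "same_position y (g y)"
        using g y by (auto simp: same_position_def lin_isometry_closed)
    qed
    then show "g = f"
      using g by (intro extensionalityI[of _ "vecs Y"]) (auto simp: f_def)
  qed (simp_all add: f_psi f_ext)
qed


section \<open>The Banach space \<open>L\<^sup>p\<close>\<close>

definition Lp_seminorm :: "'x measure \<Rightarrow> real \<Rightarrow> ('x \<Rightarrow> real) \<Rightarrow> real" where
  "Lp_seminorm M p u = (\<integral>x. \<bar>u x\<bar> powr p \<partial>M) powr (1 / p)"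

definition Lp_class :: "'x measure \<Rightarrow> real \<Rightarrow> ('x \<Rightarrow> real) \<Rightarrow> ('x \<Rightarrow> real) set" where
  "Lp_class M p u = ae_rel M p `` {u}"

lemma Lp_funD:
  assumes "u \<in> Lp_fun M p"
  shows "u \<in> borel_measurable M" "integrable M (\<lambda>x. \<bar>u x\<bar> powr p)"
  using assms by (auto simp: Lp_fun_def)

lemma Lp_funI: "u \<in> borel_measurable M \<Longrightarrow> integrable M (\<lambda>x. \<bar>u x\<bar> powr p) \<Longrightarrow> u \<in> Lp_fun M p"
  by (simp add: Lp_fun_def)

lemma Lp_fun_dominated:
  assumes p: "0 \<le> p" and w: "w \<in> Lp_fun M p" and u: "u \<in> borel_measurable M"
    and le: "\<And>x. x \<in> space M \<Longrightarrow> \<bar>u x\<bar> \<le> \<bar>w x\<bar>"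
  shows "u \<in> Lp_fun M p"
proof (rule Lp_funI[OF u])
  have [measurable]: "u \<in> borel_measurable M" "w \<in> borel_measurable M"
    using u Lp_funD(1)[OF w] by auto
  show "integrable M (\<lambda>x. \<bar>u x\<bar> powr p)"
    using le p by (intro Bochner_Integration.integrable_bound[OF Lp_funD(2)[OF w]] AE_I2)
      (auto intro: powr_mono2)
qed

lemma Lp_fun_cmult:
  assumes "u \<in> Lp_fun M p"
  shows "(\<lambda>x. c * u x) \<in> Lp_fun M p"
  using assms by (auto simp: Lp_fun_def abs_mult powr_mult)

lemma Lp_fun_zero: "(\<lambda>x. 0) \<in> Lp_fun M p"
  by (simp add: Lp_fun_def)

lemma abs_add_powr_le:
  fixes a b p :: real
  assumes p: "0 \<le> p"
  shows "\<bar>a + b\<bar> powr p \<le> 2 powr p * (\<bar>a\<bar> powr p + \<bar>b\<bar> powr p)"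
proof -
  have "\<bar>a + b\<bar> powr p \<le> (2 * max \<bar>a\<bar> \<bar>b\<bar>) powr p"
    using p by (intro powr_mono2) auto
  also have "\<dots> = 2 powr p * max \<bar>a\<bar> \<bar>b\<bar> powr p"
    by (rule powr_mult)
  also have "\<dots> \<le> 2 powr p * (\<bar>a\<bar> powr p + \<bar>b\<bar> powr p)"
    by (intro mult_left_mono) (auto simp: max_def)
  finally show ?thesis .
qed

lemma Lp_fun_add:
  assumes p: "0 \<le> p" and u: "u \<in> Lp_fun M p" and v: "v \<in> Lp_fun M p"
  shows "(\<lambda>x. u x + v x) \<in> Lp_fun M p"
proof (rule Lp_funI)
  have [measurable]: "u \<in> borel_measurable M" "v \<in> borel_measurable M"
    using u v by (auto simp: Lp_fun_def)
  show "(\<lambda>x. u x + v x) \<in> borel_measurable M"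
    by simp
  have "integrable M (\<lambda>x. 2 powr p * (\<bar>u x\<bar> powr p + \<bar>v x\<bar> powr p))"
    using Lp_funD(2)[OF u] Lp_funD(2)[OF v] by simp
  then show "integrable M (\<lambda>x. \<bar>u x + v x\<bar> powr p)"
    by (rule Bochner_Integration.integrable_bound) (use abs_add_powr_le[OF p] in auto)
qed

lemma Lp_fun_diff:
  assumes "0 \<le> p" "u \<in> Lp_fun M p" "v \<in> Lp_fun M p"
  shows "(\<lambda>x. u x - v x) \<in> Lp_fun M p"
  using Lp_fun_add[OF assms(1,2) Lp_fun_cmult[OF assms(3), of "-1"]] by simp

lemma Lp_seminorm_nonneg: "0 \<le> Lp_seminorm M p u"
  by (simp add: Lp_seminorm_def)

lemma Lp_seminorm_powr: "p \<noteq> 0 \<Longrightarrow> Lp_seminorm M p u powr p = (\<integral>x. \<bar>u x\<bar> powr p \<partial>M)"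
  by (simp add: Lp_seminorm_def powr_powr)

lemma Lp_seminorm_le_iff:
  assumes "0 < p" "0 \<le> c"
  shows "Lp_seminorm M p u \<le> c \<longleftrightarrow> (\<integral>x. \<bar>u x\<bar> powr p \<partial>M) \<le> c powr p"
  using assms Lp_seminorm_powr[of p M u]
    powr_mono2[of p "Lp_seminorm M p u" c] powr_less_mono2[of p c "Lp_seminorm M p u"]
  by (force simp: Lp_seminorm_nonneg not_le[symmetric])

lemma Lp_seminorm_cong: "(\<And>x. x \<in> space M \<Longrightarrow> u x = v x) \<Longrightarrow> Lp_seminorm M p u = Lp_seminorm M p v"
  unfolding Lp_seminorm_def by (auto cong: Bochner_Integration.integral_cong)

lemma Lp_seminorm_cong_AE:
  assumes "u \<in> borel_measurable M" "v \<in> borel_measurable M" "AE x in M. u x = v x"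
  shows "Lp_seminorm M p u = Lp_seminorm M p v"
proof -
  have "(\<integral>x. \<bar>u x\<bar> powr p \<partial>M) = (\<integral>x. \<bar>v x\<bar> powr p \<partial>M)"
    using assms by (intro integral_cong_AE) auto
  then show ?thesis
    by (simp add: Lp_seminorm_def)
qed

lemma Lp_seminorm_cmult:
  assumes "p \<noteq> 0"
  shows "Lp_seminorm M p (\<lambda>x. c * u x) = \<bar>c\<bar> * Lp_seminorm M p u"
  using assms by (simp add: Lp_seminorm_def abs_mult powr_mult powr_powr)

lemma Lp_seminorm_eq_0_iff:
  assumes u: "u \<in> Lp_fun M p"
  shows "Lp_seminorm M p u = 0 \<longleftrightarrow> (AE x in M. u x = 0)"
  using integral_nonneg_eq_0_iff_AE[OF Lp_funD(2)[OF u]] by (simp add: Lp_seminorm_def)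

text \<open>
  Convexity on the open half line is known; when one of the points is \<open>0\<close> the claim becomes
  \<open>(s * z) powr p \<le> s * z powr p\<close> for \<open>s < 1\<close>.
\<close>
lemma convex_on_powr_nonneg:
  assumes p: "1 \<le> p"
  shows "convex_on {0..} (\<lambda>x::real. x powr p)"
proof
  fix t x y :: real
  assume t: "0 < t" "t < 1" and xy: "x \<in> {0..}" "y \<in> {0..}"
  have shrink: "(s * z) powr p \<le> s * z powr p" if "0 < s" "s < 1" for s z :: real
  proof -
    have "s powr p \<le> s powr 1"
      using that p by (intro powr_mono') auto
    then show ?thesis
      using that by (simp add: powr_mult mult_right_mono)
  qed
  show "((1 - t) *\<^sub>R x + t *\<^sub>R y) powr p \<le> (1 - t) * x powr p + t * y powr p"
  proof (cases "x = 0 \<or> y = 0")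
    case True
    then show ?thesis
      using shrink[of t y] shrink[of "1 - t" x] t by auto
  next
    case False
    then show ?thesis
      using convex_onD[OF powr_convex[OF p], of t x y] t xy by auto
  qed
qed simp

text \<open>
  Minkowski's inequality. Write \<open>A\<close> and \<open>B\<close> for the two seminorms. When both are positive,
  \<open>(\<bar>u\<bar> + \<bar>v\<bar>) / (A + B)\<close> is the convex combination of \<open>\<bar>u\<bar> / A\<close> and \<open>\<bar>v\<bar> / B\<close> with weights
  proportional to \<open>A\<close> and \<open>B\<close>; convexity of the \<open>p\<close>-th power bounds the integral of its \<open>p\<close>-th
  power by \<open>1\<close>.
\<close>
lemma Lp_seminorm_triangle:
  assumes p: "1 \<le> p" and u: "u \<in> Lp_fun M p" and v: "v \<in> Lp_fun M p"
  shows "Lp_seminorm M p (\<lambda>x. u x + v x) \<le> Lp_seminorm M p u + Lp_seminorm M p v"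
proof -
  define A where "A = Lp_seminorm M p u"
  define B where "B = Lp_seminorm M p v"
  note meas = Lp_funD(1)[OF u] Lp_funD(1)[OF v]
  have uv: "(\<lambda>x. u x + v x) \<in> Lp_fun M p"
    using p u v by (intro Lp_fun_add) auto
  consider "A = 0" | "B = 0" | "0 < A" "0 < B"
    using Lp_seminorm_nonneg[of M p u] Lp_seminorm_nonneg[of M p v] by (force simp: A_def B_def)
  then show ?thesis
  proof cases
    case 1
    then have "AE x in M. u x = 0"
      using Lp_seminorm_eq_0_iff[OF u] by (simp add: A_def)
    then have "Lp_seminorm M p (\<lambda>x. u x + v x) = Lp_seminorm M p v"
      using meas by (intro Lp_seminorm_cong_AE) auto
    then show ?thesis
      by (simp add: Lp_seminorm_nonneg)
  next
    case 2
    then have "AE x in M. v x = 0"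
      using Lp_seminorm_eq_0_iff[OF v] by (simp add: B_def)
    then have "Lp_seminorm M p (\<lambda>x. u x + v x) = Lp_seminorm M p u"
      using meas by (intro Lp_seminorm_cong_AE) auto
    then show ?thesis
      by (simp add: Lp_seminorm_nonneg)
  next
    case 3
    define t where "t = B / (A + B)"
    have t: "0 \<le> t" "t \<le> 1" "(1 - t) * (A + B) = A" "t * (A + B) = B"
      using 3 by (auto simp: t_def field_simps)
    have pointwise: "\<bar>u x + v x\<bar> powr p \<le>
        (A + B) powr p * ((1 - t) * (\<bar>u x\<bar> powr p / A powr p) + t * (\<bar>v x\<bar> powr p / B powr p))" for x
    proof -
      have eq: "\<bar>u x\<bar> + \<bar>v x\<bar> = (A + B) * ((1 - t) * (\<bar>u x\<bar> / A) + t * (\<bar>v x\<bar> / B))"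
      proof -
        have "(A + B) * ((1 - t) * a + t * b) = ((1 - t) * (A + B)) * a + (t * (A + B)) * b" for a b
          by (simp add: algebra_simps)
        from this[of "\<bar>u x\<bar> / A" "\<bar>v x\<bar> / B"] show ?thesis
          unfolding t(3,4) using 3 by simp
      qed
      have "\<bar>u x + v x\<bar> powr p \<le> (\<bar>u x\<bar> + \<bar>v x\<bar>) powr p"
        using p by (intro powr_mono2) auto
      also have "\<dots> = ((A + B) * ((1 - t) * (\<bar>u x\<bar> / A) + t * (\<bar>v x\<bar> / B))) powr p"
        by (simp only: eq)
      also have "\<dots> = (A + B) powr p * ((1 - t) * (\<bar>u x\<bar> / A) + t * (\<bar>v x\<bar> / B)) powr p"
        by (rule powr_mult)
      also have "((1 - t) * (\<bar>u x\<bar> / A) + t * (\<bar>v x\<bar> / B)) powr p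
          \<le> (1 - t) * (\<bar>u x\<bar> / A) powr p + t * (\<bar>v x\<bar> / B) powr p"
        using convex_onD[OF convex_on_powr_nonneg[OF p], of t "\<bar>u x\<bar> / A" "\<bar>v x\<bar> / B"] t 3 by simp
      finally show ?thesis
        using 3 by (simp add: powr_divide mult_left_mono)
    qed
    have "(\<integral>x. \<bar>u x + v x\<bar> powr p \<partial>M) \<le> (\<integral>x. (A + B) powr p *
        ((1 - t) * (\<bar>u x\<bar> powr p / A powr p) + t * (\<bar>v x\<bar> powr p / B powr p)) \<partial>M)"
      using Lp_funD(2)[OF u] Lp_funD(2)[OF v] Lp_funD(2)[OF uv] pointwise
      by (intro integral_mono) auto
    also have "\<dots> = (A + B) powr p * ((1 - t) * (A powr p / A powr p) + t * (B powr p / B powr p))"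
      using Lp_funD(2)[OF u] Lp_funD(2)[OF v] p
      by (simp add: A_def B_def Lp_seminorm_powr)
    also have "\<dots> = (A + B) powr p"
      using 3 by simp
    finally show ?thesis
      using p 3 by (subst Lp_seminorm_le_iff) (auto simp: A_def[symmetric] B_def[symmetric])
  qed
qed

lemma Lp_seminorm_diff_commute: "Lp_seminorm M p (\<lambda>x. u x - v x) = Lp_seminorm M p (\<lambda>x. v x - u x)"
  by (simp add: Lp_seminorm_def abs_minus_commute)

lemma Lp_seminorm_diff_triangle:
  assumes p: "1 \<le> p" and "u \<in> Lp_fun M p" "v \<in> Lp_fun M p" "w \<in> Lp_fun M p"
  shows "Lp_seminorm M p (\<lambda>x. u x - w x) \<le> Lp_seminorm M p (\<lambda>x. u x - v x) + Lp_seminorm M p (\<lambda>x. v x - w x)"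
  using Lp_seminorm_triangle[OF p Lp_fun_diff[of p u M v] Lp_fun_diff[of p v M w]] assms by simp

lemma nn_integral_Lp_fun:
  assumes "u \<in> Lp_fun M p" "p \<noteq> 0"
  shows "(\<integral>\<^sup>+x. ennreal (\<bar>u x\<bar> powr p) \<partial>M) = ennreal (Lp_seminorm M p u powr p)"
  using Lp_funD(2)[OF assms(1)] assms(2) by (simp add: nn_integral_eq_integral Lp_seminorm_powr)

lemma Lp_fun_if_nn_integral_le:
  assumes p: "0 < p" and c: "0 \<le> c" and u: "u \<in> borel_measurable M"
    and le: "(\<integral>\<^sup>+x. ennreal (\<bar>u x\<bar> powr p) \<partial>M) \<le> ennreal (c powr p)"
  shows "u \<in> Lp_fun M p" "Lp_seminorm M p u \<le> c"
proof -
  have [measurable]: "u \<in> borel_measurable M" by fact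
  have "(\<integral>\<^sup>+x. ennreal (\<bar>u x\<bar> powr p) \<partial>M) < \<infinity>"
    using le by (rule order.strict_trans1) simp
  then show "u \<in> Lp_fun M p"
    using u by (intro Lp_funI integrableI_nonneg) auto
  from nn_integral_Lp_fun[OF this, of] p le have "Lp_seminorm M p u powr p \<le> c powr p"
    by simp
  then show "Lp_seminorm M p u \<le> c"
    using p c by (simp add: Lp_seminorm_le_iff Lp_seminorm_powr)
qed

text \<open>
  The factor \<open>2 ^ k\<close> makes the mere boundedness of the terms sufficient for geometric decay of the
  increments. In the completeness proof this avoids summing the increments in norm.
\<close>
lemma convergent_if_weighted_increments_summable:
  fixes a :: "nat \<Rightarrow> real"
  assumes p: "0 < p" and sum: "summable (\<lambda>k. \<bar>2 ^ k * (a (Suc k) - a k)\<bar> powr p)"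
  shows "convergent a"
proof -
  have "eventually (\<lambda>k. \<bar>2 ^ k * (a (Suc k) - a k)\<bar> powr p < 1) sequentially"
    using summable_LIMSEQ_zero[OF sum] by (rule order_tendstoD) simp
  then have "eventually (\<lambda>k. norm (a (Suc k) - a k) \<le> (1 / 2) ^ k) sequentially"
  proof eventually_elim
    case (elim k)
    then have "\<not> 1 \<le> \<bar>2 ^ k * (a (Suc k) - a k)\<bar>"
      using powr_mono2[of p 1 "\<bar>2 ^ k * (a (Suc k) - a k)\<bar>"] p by auto
    then have "2 ^ k * \<bar>a (Suc k) - a k\<bar> < 1"
      by (simp add: abs_mult)
    then show ?case
      by (simp add: power_one_over field_simps)
  qed
  then have "summable (\<lambda>k. a (Suc k) - a k)"
    by (rule summable_comparison_test_ev) (simp add: summable_geometric)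
  then have "convergent (\<lambda>n. a 0 + (\<Sum>k<n. a (Suc k) - a k))"
    by (intro convergent_add convergent_const) (simp add: summable_iff_convergent)
  then show ?thesis
    by (simp add: sum_lessThan_telescope)
qed

text \<open>
  The Riesz--Fischer theorem. A subsequence with rapidly decreasing increments converges almost
  everywhere; Fatou's lemma transfers the Cauchy estimate to its limit.
\<close>
lemma Lp_fun_complete:
  assumes p: "1 \<le> p" and u: "\<And>n. u n \<in> Lp_fun M p"
    and Cauchy: "\<And>e. 0 < e \<Longrightarrow> \<exists>N. \<forall>m\<ge>N. \<forall>n\<ge>N. Lp_seminorm M p (\<lambda>x. u m x - u n x) < e"
  shows "\<exists>v\<in>Lp_fun M p. (\<lambda>n. Lp_seminorm M p (\<lambda>x. u n x - v x)) \<longlonglongrightarrow> 0"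
proof -
  have [measurable]: "u n \<in> borel_measurable M" for n
    using Lp_funD(1)[OF u] .
  \<comment> \<open>With the bound \<open>(1 / 4) ^ k\<close> the increments remain summable after multiplication by \<open>2 ^ k\<close>.\<close>
  obtain N where N: "\<And>k m n. m \<ge> N k \<Longrightarrow> n \<ge> N k \<Longrightarrow> Lp_seminorm M p (\<lambda>x. u m x - u n x) < (1 / 4) ^ k"
    using Cauchy[of "(1 / 4) ^ k" for k] by (metis zero_less_divide_1_iff zero_less_numeral zero_less_power)
  \<comment> \<open>The partial sums make \<open>r (Suc k)\<close> exceed \<open>N k\<close> as well; the summand \<open>k\<close> makes \<open>r\<close> unbounded.\<close>
  define r where "r k = k + (\<Sum>i\<le>k. N i)" for k
  have r: "r k \<ge> k" "r k \<ge> N k" "r (Suc k) \<ge> N k" for k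
    using member_le_sum[of k "{..k}" N] by (auto simp: r_def)
  define h where "h k x = \<bar>2 ^ k * (u (r (Suc k)) x - u (r k) x)\<bar> powr p" for k x
  have [measurable]: "h k \<in> borel_measurable M" for k
    unfolding h_def[abs_def] by measurable
  have h_int: "(\<integral>\<^sup>+x. ennreal (h k x) \<partial>M) \<le> ennreal ((1 / 2) ^ k)" for k
  proof -
    let ?d = "\<lambda>x. u (r (Suc k)) x - u (r k) x"
    have d: "?d \<in> Lp_fun M p"
      using p u by (intro Lp_fun_diff) auto
    have "2 ^ k * Lp_seminorm M p ?d \<le> 2 ^ k * (1 / 4) ^ k"
      using N[OF r(3,2)[of k]] by (intro mult_left_mono) auto
    also have "\<dots> = (1 / 2) ^ k"
      by (simp add: power_mult_distrib[symmetric])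
    finally have small: "2 ^ k * Lp_seminorm M p ?d \<le> (1 / 2) ^ k" .
    have "(\<integral>\<^sup>+x. ennreal (h k x) \<partial>M) = ennreal ((2 ^ k * Lp_seminorm M p ?d) powr p)"
      unfolding h_def using nn_integral_Lp_fun[OF Lp_fun_cmult[OF d, of "2 ^ k"]] p
      by (simp add: Lp_seminorm_cmult)
    also have "(2 ^ k * Lp_seminorm M p ?d) powr p \<le> ((1 / 2) ^ k) powr p"
      using small p by (intro powr_mono2) (auto simp: Lp_seminorm_nonneg)
    also have "\<dots> \<le> ((1 / 2) ^ k) powr 1"
      using p by (intro powr_mono') (auto simp: power_le_one)
    finally show ?thesis
      by (simp add: ennreal_leI)
  qed
  have "(\<integral>\<^sup>+x. (\<Sum>k. ennreal (h k x)) \<partial>M) = (\<Sum>k. \<integral>\<^sup>+x. ennreal (h k x) \<partial>M)"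
    by (rule nn_integral_suminf) simp
  also have "\<dots> \<le> (\<Sum>k. ennreal ((1 / 2) ^ k))"
    using h_int by (intro suminf_le) auto
  also have "\<dots> = ennreal (\<Sum>k. (1 / 2) ^ k)"
    by (rule suminf_ennreal2) (auto simp: summable_geometric)
  finally have "(\<integral>\<^sup>+x. (\<Sum>k. ennreal (h k x)) \<partial>M) \<noteq> \<infinity>"
    by (auto simp: top_unique)
  then have "AE x in M. (\<Sum>k. ennreal (h k x)) \<noteq> \<infinity>"
    by (intro nn_integral_noteq_infinite) auto
  then have conv: "AE x in M. convergent (\<lambda>k. u (r k) x)"
  proof eventually_elim
    case (elim x)
    then have "summable (\<lambda>k. h k x)"
      by (intro summable_suminf_not_top) (auto simp: h_def)
    then show ?case
      using p by (intro convergent_if_weighted_increments_summable[of p]) (auto simp: h_def)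
  qed
  define v where "v x = lim (\<lambda>k. u (r k) x)" for x
  have [measurable]: "v \<in> borel_measurable M"
    unfolding v_def by measurable
  have bound: "(\<lambda>x. u n x - v x) \<in> Lp_fun M p \<and> Lp_seminorm M p (\<lambda>x. u n x - v x) \<le> e"
    if e: "0 < e" and K: "\<And>m. m \<ge> K \<Longrightarrow> Lp_seminorm M p (\<lambda>x. u n x - u m x) \<le> e" for n e K
  proof -
    have "(\<integral>\<^sup>+x. ennreal (\<bar>u n x - v x\<bar> powr p) \<partial>M)
        = (\<integral>\<^sup>+x. liminf (\<lambda>k. ennreal (\<bar>u n x - u (r k) x\<bar> powr p)) \<partial>M)"
    proof (rule nn_integral_cong_AE, use conv in eventually_elim)
      case (elim x)
      then have "(\<lambda>k. u (r k) x) \<longlonglongrightarrow> v x"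
        by (simp add: v_def convergent_LIMSEQ_iff)
      then have "(\<lambda>k. ennreal (\<bar>u n x - u (r k) x\<bar> powr p)) \<longlonglongrightarrow> ennreal (\<bar>u n x - v x\<bar> powr p)"
        using p by (intro tendsto_ennrealI tendsto_powr' tendsto_intros) auto
      then show ?case
        by (intro lim_imp_Liminf[symmetric]) auto
    qed
    also have "\<dots> \<le> liminf (\<lambda>k. \<integral>\<^sup>+x. ennreal (\<bar>u n x - u (r k) x\<bar> powr p) \<partial>M)"
      by (rule nn_integral_liminf) simp
    also have "\<dots> \<le> limsup (\<lambda>k. \<integral>\<^sup>+x. ennreal (\<bar>u n x - u (r k) x\<bar> powr p) \<partial>M)"
      by (rule Liminf_le_Limsup) simp
    also have "\<dots> \<le> ennreal (e powr p)"
    proof (rule Limsup_bounded, unfold eventually_sequentially, intro exI[of _ K] allI impI)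
      fix k assume "K \<le> k"
      then have "Lp_seminorm M p (\<lambda>x. u n x - u (r k) x) powr p \<le> e powr p"
        using K[of "r k"] r(1)[of k] p by (intro powr_mono2) (auto simp: Lp_seminorm_nonneg)
      moreover have "(\<lambda>x. u n x - u (r k) x) \<in> Lp_fun M p"
        using p u by (intro Lp_fun_diff) auto
      ultimately show "(\<integral>\<^sup>+x. ennreal (\<bar>u n x - u (r k) x\<bar> powr p) \<partial>M) \<le> ennreal (e powr p)"
        using p by (simp add: nn_integral_Lp_fun ennreal_leI)
    qed
    finally show ?thesis
      using Lp_fun_if_nn_integral_le[of p e "\<lambda>x. u n x - v x" M] p e by auto
  qed
  have close: "\<exists>K. \<forall>n\<ge>K. (\<lambda>x. u n x - v x) \<in> Lp_fun M p \<and> Lp_seminorm M p (\<lambda>x. u n x - v x) \<le> e" if e: "0 < e" for e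
  proof -
    obtain K where "\<And>m n. m \<ge> K \<Longrightarrow> n \<ge> K \<Longrightarrow> Lp_seminorm M p (\<lambda>x. u m x - u n x) < e"
      using Cauchy[OF e] by blast
    then show ?thesis
      using bound[OF e, of K] less_imp_le by blast
  qed
  obtain n where "(\<lambda>x. u n x - v x) \<in> Lp_fun M p"
    using close[of 1] by auto
  from Lp_fun_diff[OF _ u[of n] this] p have "v \<in> Lp_fun M p"
    by simp
  moreover have "(\<lambda>n. Lp_seminorm M p (\<lambda>x. u n x - v x)) \<longlonglongrightarrow> 0"
  proof (rule LIMSEQ_I)
    fix e :: real assume "0 < e"
    then obtain K where K: "\<And>n. n \<ge> K \<Longrightarrow> Lp_seminorm M p (\<lambda>x. u n x - v x) \<le> e / 2"
      using close[of "e / 2"] by auto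
    have "norm (Lp_seminorm M p (\<lambda>x. u n x - v x) - 0) < e" if "n \<ge> K" for n
      using K[OF that] \<open>0 < e\<close> Lp_seminorm_nonneg[of M p "\<lambda>x. u n x - v x"] by simp
    then show "\<exists>K. \<forall>n\<ge>K. norm (Lp_seminorm M p (\<lambda>x. u n x - v x) - 0) < e"
      by blast
  qed
  ultimately show ?thesis
    by blast
qed

lemma equiv_ae_rel: "equiv (Lp_fun M p) (ae_rel M p)"
proof (rule equivI)
  show "ae_rel M p \<subseteq> Lp_fun M p \<times> Lp_fun M p" "refl_on (Lp_fun M p) (ae_rel M p)"
    by (auto simp: ae_rel_def refl_on_def)
  show "sym (ae_rel M p)"
    by (auto simp: ae_rel_def sym_def elim: eventually_mono)
  show "trans (ae_rel M p)"
  proof (rule transI)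
    fix u v w assume "(u, v) \<in> ae_rel M p" "(v, w) \<in> ae_rel M p"
    then have *: "u \<in> Lp_fun M p" "w \<in> Lp_fun M p" "AE x in M. u x = v x" "AE x in M. v x = w x"
      by (auto simp: ae_rel_def)
    from *(3,4) have "AE x in M. u x = w x"
      by eventually_elim simp
    then show "(u, w) \<in> ae_rel M p"
      using * by (simp add: ae_rel_def)
  qed
qed

lemma Lp_class_eq_iff:
  "u \<in> Lp_fun M p \<Longrightarrow> v \<in> Lp_fun M p \<Longrightarrow> Lp_class M p u = Lp_class M p v \<longleftrightarrow> (AE x in M. u x = v x)"
  using eq_equiv_class_iff[OF equiv_ae_rel, of u M p v] by (simp add: Lp_class_def ae_rel_def)

lemma mem_Lp_class: "v \<in> Lp_class M p u \<longleftrightarrow> u \<in> Lp_fun M p \<and> v \<in> Lp_fun M p \<and> (AE x in M. u x = v x)"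
  by (simp add: Lp_class_def ae_rel_def)

lemma Lp_class_self: "u \<in> Lp_fun M p \<Longrightarrow> u \<in> Lp_class M p u"
  by (simp add: mem_Lp_class)

lemma vecs_Lp: "vecs (Lp M p) = Lp_class M p ` Lp_fun M p"
  by (auto simp: Lp_def quotient_def Lp_class_def)

lemma Lp_class_in_vecs: "u \<in> Lp_fun M p \<Longrightarrow> Lp_class M p u \<in> vecs (Lp M p)"
  by (simp add: vecs_Lp)

lemma UN_const_class: "x \<in> A \<Longrightarrow> (\<And>y. y \<in> A \<Longrightarrow> f y = c) \<Longrightarrow> (\<Union>y\<in>A. f y) = c"
  by auto

lemma vadd_Lp:
  assumes p: "0 \<le> p" and u: "u \<in> Lp_fun M p" and v: "v \<in> Lp_fun M p"
  shows "vadd (Lp M p) (Lp_class M p u) (Lp_class M p v) = Lp_class M p (\<lambda>x. u x + v x)"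
proof -
  have "Lp_class M p (\<lambda>x. u' x + v' x) = Lp_class M p (\<lambda>x. u x + v x)"
    if "u' \<in> Lp_class M p u" "v' \<in> Lp_class M p v" for u' v'
  proof -
    have "AE x in M. u x = u' x" "AE x in M. v x = v' x"
      using that by (auto simp: mem_Lp_class)
    then have "AE x in M. u' x + v' x = u x + v x"
      by eventually_elim simp
    then show ?thesis
      using that p u v by (simp add: Lp_class_eq_iff mem_Lp_class Lp_fun_add)
  qed
  then have "(\<Union>u'\<in>Lp_class M p u. \<Union>v'\<in>Lp_class M p v. Lp_class M p (\<lambda>x. u' x + v' x))
      = Lp_class M p (\<lambda>x. u x + v x)"
    by (intro UN_const_class[OF Lp_class_self[OF u]] UN_const_class[OF Lp_class_self[OF v]])
  then show ?thesis
    by (simp add: Lp_def Lp_class_def)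
qed

lemma vscale_Lp:
  assumes u: "u \<in> Lp_fun M p"
  shows "vscale (Lp M p) c (Lp_class M p u) = Lp_class M p (\<lambda>x. c * u x)"
proof -
  have "Lp_class M p (\<lambda>x. c * u' x) = Lp_class M p (\<lambda>x. c * u x)" if "u' \<in> Lp_class M p u" for u'
  proof -
    have "AE x in M. u x = u' x"
      using that by (simp add: mem_Lp_class)
    then have "AE x in M. c * u' x = c * u x"
      by eventually_elim simp
    then show ?thesis
      using that u by (simp add: Lp_class_eq_iff mem_Lp_class Lp_fun_cmult)
  qed
  then have "(\<Union>u'\<in>Lp_class M p u. Lp_class M p (\<lambda>x. c * u' x)) = Lp_class M p (\<lambda>x. c * u x)"
    by (rule UN_const_class[OF Lp_class_self[OF u]])
  then show ?thesis
    by (simp add: Lp_def Lp_class_def)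
qed

lemma vzero_Lp: "vzero (Lp M p) = Lp_class M p (\<lambda>x. 0)"
  by (simp add: Lp_def Lp_class_def)

lemma vnorm_Lp:
  assumes u: "u \<in> Lp_fun M p"
  shows "vnorm (Lp M p) (Lp_class M p u) = Lp_seminorm M p u"
proof -
  have "Lp_seminorm M p u' = Lp_seminorm M p u" if "u' \<in> Lp_class M p u" for u'
    using that Lp_seminorm_cong_AE[of u M u' p] by (simp add: mem_Lp_class Lp_fun_def)
  then have "Lp_seminorm M p ` Lp_class M p u = (\<lambda>_. Lp_seminorm M p u) ` Lp_class M p u"
    by (rule image_cong[OF refl])
  also have "\<dots> = {Lp_seminorm M p u}"
    using Lp_class_self[OF u] by auto
  finally show ?thesis
    by (simp add: Lp_def Lp_seminorm_def[abs_def])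
qed

lemma vdist_Lp:
  assumes "0 \<le> p" "u \<in> Lp_fun M p" "v \<in> Lp_fun M p"
  shows "vdist (Lp M p) (Lp_class M p u) (Lp_class M p v) = Lp_seminorm M p (\<lambda>x. u x - v x)"
proof -
  have "(\<lambda>x. u x + - v x) \<in> Lp_fun M p"
    using Lp_fun_diff[OF assms] by simp
  then show ?thesis
    using assms Lp_fun_cmult[OF assms(3), of "-1"] by (simp add: vdist_def vscale_Lp vadd_Lp vnorm_Lp)
qed

lemma real_banach_Lp:
  assumes p: "1 \<le> p"
  shows "real_banach (Lp M p)"
proof -
  note [simp] = vadd_Lp vscale_Lp vzero_Lp vnorm_Lp Lp_fun_add Lp_fun_cmult Lp_fun_zero Lp_class_in_vecs
  have p0: "0 \<le> p" "p \<noteq> 0"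
    using p by auto
  have rep: "\<exists>u\<in>Lp_fun M p. U = Lp_class M p u" if "U \<in> vecs (Lp M p)" for U
    using that by (auto simp: vecs_Lp)
  show ?thesis
  proof
    show "vzero (Lp M p) \<in> vecs (Lp M p)"
      by simp
  next
    fix U V assume "U \<in> vecs (Lp M p)" "V \<in> vecs (Lp M p)"
    then obtain u v where uv: "u \<in> Lp_fun M p" "v \<in> Lp_fun M p" "U = Lp_class M p u" "V = Lp_class M p v"
      using rep by metis
    then show "vadd (Lp M p) U V \<in> vecs (Lp M p)" "vadd (Lp M p) U V = vadd (Lp M p) V U"
      "vnorm (Lp M p) (vadd (Lp M p) U V) \<le> vnorm (Lp M p) U + vnorm (Lp M p) V"
      "vscale (Lp M p) c (vadd (Lp M p) U V)
        = vadd (Lp M p) (vscale (Lp M p) c U) (vscale (Lp M p) c V)" for c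
      using p0 p by (simp_all add: add.commute Lp_seminorm_triangle algebra_simps)
    fix W assume "W \<in> vecs (Lp M p)"
    then obtain w where "w \<in> Lp_fun M p" "W = Lp_class M p w"
      using rep by metis
    then show "vadd (Lp M p) (vadd (Lp M p) U V) W = vadd (Lp M p) U (vadd (Lp M p) V W)"
      using p0 uv by (simp add: add.assoc)
  next
    fix U assume "U \<in> vecs (Lp M p)"
    then obtain u where u: "u \<in> Lp_fun M p" "U = Lp_class M p u"
      using rep by metis
    then show "vscale (Lp M p) c U \<in> vecs (Lp M p)" "vadd (Lp M p) U (vzero (Lp M p)) = U"
      "vadd (Lp M p) U (vscale (Lp M p) (- 1) U) = vzero (Lp M p)"
      "vscale (Lp M p) (c + d) U = vadd (Lp M p) (vscale (Lp M p) c U) (vscale (Lp M p) d U)"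
      "vscale (Lp M p) c (vscale (Lp M p) d U) = vscale (Lp M p) (c * d) U"
      "vscale (Lp M p) 1 U = U" "0 \<le> vnorm (Lp M p) U"
      "vnorm (Lp M p) (vscale (Lp M p) c U) = \<bar>c\<bar> * vnorm (Lp M p) U" for c d
      using p0 Lp_fun_cmult[OF u(1), of "-1"]
      by (simp_all add: algebra_simps Lp_seminorm_nonneg Lp_seminorm_cmult)
    show "vnorm (Lp M p) U = 0 \<longleftrightarrow> U = vzero (Lp M p)"
      using u by (simp add: Lp_seminorm_eq_0_iff Lp_class_eq_iff)
  next
    fix s :: "nat \<Rightarrow> _" assume s: "\<forall>n. s n \<in> vecs (Lp M p)"
      and Cauchy: "\<forall>e>0. \<exists>N. \<forall>m\<ge>N. \<forall>n\<ge>N. vdist (Lp M p) (s m) (s n) < e"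
    have "\<forall>n. \<exists>u. u \<in> Lp_fun M p \<and> s n = Lp_class M p u"
      using rep s by blast
    from choice[OF this] obtain u where u: "\<And>n. u n \<in> Lp_fun M p" "\<And>n. s n = Lp_class M p (u n)"
      by blast
    have "\<exists>v\<in>Lp_fun M p. (\<lambda>n. Lp_seminorm M p (\<lambda>x. u n x - v x)) \<longlonglongrightarrow> 0"
      using Cauchy u p0 by (intro Lp_fun_complete[OF p]) (auto simp: vdist_Lp)
    then show "\<exists>x\<in>vecs (Lp M p). (\<lambda>n. vdist (Lp M p) (s n) x) \<longlonglongrightarrow> 0"
      using u p0 by (auto simp: vdist_Lp vecs_Lp)
  qed
qed


section \<open>Pulling back along measure preserving maps\<close>

lemma Lp_fun_comp:
  assumes f: "mpres M N f" and u: "u \<in> Lp_fun N p"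
  shows "u \<circ> f \<in> Lp_fun M p"
proof (rule Lp_funI)
  have [measurable]: "f \<in> measurable M N" "u \<in> borel_measurable N"
    using f u by (auto simp: mpres_def Lp_fun_def)
  show "u \<circ> f \<in> borel_measurable M"
    by (simp add: comp_def)
  have "integrable (distr M N f) (\<lambda>x. \<bar>u x\<bar> powr p)"
    using f Lp_funD(2)[OF u] by (simp add: mpres_def)
  then show "integrable M (\<lambda>x. \<bar>(u \<circ> f) x\<bar> powr p)"
    by (simp add: integrable_distr_eq)
qed

lemma Lp_seminorm_comp:
  assumes f: "mpres M N f" and u: "u \<in> Lp_fun N p"
  shows "Lp_seminorm M p (u \<circ> f) = Lp_seminorm N p u"
proof -
  have [measurable]: "f \<in> measurable M N" "u \<in> borel_measurable N"
    using f u by (auto simp: mpres_def Lp_fun_def)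
  have "(\<integral>x. \<bar>u x\<bar> powr p \<partial>N) = (\<integral>x. \<bar>u x\<bar> powr p \<partial>(distr M N f))"
    using f by (simp add: mpres_def)
  then show ?thesis
    by (simp add: Lp_seminorm_def integral_distr)
qed

lemma Lp_pull_class:
  assumes f: "mpres M N f" and u: "u \<in> Lp_fun N p"
  shows "Lp_pull M p f (Lp_class N p u) = Lp_class M p (u \<circ> f)"
proof -
  have "Lp_class M p (u' \<circ> f) = Lp_class M p (u \<circ> f)" if u': "u' \<in> Lp_class N p u" for u'
  proof -
    have [measurable]: "f \<in> measurable M N"
      using f by (simp add: mpres_def)
    have "distr M N f = N" "AE x in N. u x = u' x"
      using f u' by (simp_all add: mpres_def mem_Lp_class)
    then have "AE x in distr M N f. u x = u' x"
      by (simp only:)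
    then have "AE x in M. u (f x) = u' (f x)"
      by (rule AE_distrD[rotated]) measurable
    then have "Lp_class M p (u \<circ> f) = Lp_class M p (u' \<circ> f)"
      using u' u Lp_fun_comp[OF f] by (simp add: Lp_class_eq_iff mem_Lp_class)
    then show ?thesis ..
  qed
  then have "(\<Union>u'\<in>Lp_class N p u. Lp_class M p (u' \<circ> f)) = Lp_class M p (u \<circ> f)"
    by (rule UN_const_class[OF Lp_class_self[OF u]])
  then show ?thesis
    by (simp add: Lp_pull_def Lp_class_def)
qed

lemma lin_isometry_Lp_pull:
  assumes f: "mpres M N f" and p: "0 \<le> p"
  shows "lin_isometry (Lp N p) (Lp M p) (Lp_pull M p f)"
proof -
  have comp: "(\<lambda>x. u x + v x) \<circ> f = (\<lambda>x. (u \<circ> f) x + (v \<circ> f) x)"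
    "(\<lambda>x. c * u x) \<circ> f = (\<lambda>x. c * (u \<circ> f) x)" for u v :: "_ \<Rightarrow> real" and c
    by (simp_all add: fun_eq_iff)
  show ?thesis
    using p Lp_fun_comp[OF f]
    by (auto simp: lin_isometry_def vecs_Lp vadd_Lp vscale_Lp vnorm_Lp Lp_pull_class[OF f]
        Lp_fun_add Lp_fun_cmult Lp_seminorm_comp[OF f] comp simp del: comp_apply)
qed


section \<open>Density of the functions pulled back from a cone\<close>

lemma Lp_seminorm_dominated_convergence:
  assumes p: "0 < p" and w: "w \<in> Lp_fun M p" and u: "u \<in> borel_measurable M"
    and s: "\<And>n. s n \<in> borel_measurable M"
    and lim: "\<And>x. x \<in> space M \<Longrightarrow> (\<lambda>n. s n x) \<longlonglongrightarrow> u x"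
    and le: "\<And>n x. x \<in> space M \<Longrightarrow> \<bar>s n x\<bar> \<le> \<bar>w x\<bar>"
  shows "(\<lambda>n. Lp_seminorm M p (\<lambda>x. s n x - u x)) \<longlonglongrightarrow> 0"
proof -
  have [measurable]: "u \<in> borel_measurable M" "\<And>n. s n \<in> borel_measurable M"
    using u s by auto
  have le_u: "\<bar>u x\<bar> \<le> \<bar>w x\<bar>" if "x \<in> space M" for x
    by (rule LIMSEQ_le_const2[OF tendsto_rabs[OF lim[OF that]]]) (use le[OF that] in auto)
  have "(\<lambda>n. \<integral>x. \<bar>s n x - u x\<bar> powr p \<partial>M) \<longlonglongrightarrow> (\<integral>x. 0 \<partial>M)"
  proof (rule integral_dominated_convergence)
    show "integrable M (\<lambda>x. \<bar>2 * w x\<bar> powr p)"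
      by (rule Lp_funD(2)[OF Lp_fun_cmult[OF w]])
    show "AE x in M. (\<lambda>n. \<bar>s n x - u x\<bar> powr p) \<longlonglongrightarrow> 0"
    proof (rule AE_I2)
      fix x assume "x \<in> space M"
      then have "(\<lambda>n. \<bar>s n x - u x\<bar> powr p) \<longlonglongrightarrow> \<bar>u x - u x\<bar> powr p"
        using p by (intro tendsto_powr' tendsto_intros lim) auto
      then show "(\<lambda>n. \<bar>s n x - u x\<bar> powr p) \<longlonglongrightarrow> 0"
        by simp
    qed
    show "AE x in M. norm (\<bar>s n x - u x\<bar> powr p) \<le> \<bar>2 * w x\<bar> powr p" for n
    proof (rule AE_I2)
      fix x assume x: "x \<in> space M"
      have "\<bar>s n x - u x\<bar> powr p \<le> \<bar>2 * w x\<bar> powr p"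
        using le[OF x, of n] le_u[OF x] p by (intro powr_mono2) auto
      then show "norm (\<bar>s n x - u x\<bar> powr p) \<le> \<bar>2 * w x\<bar> powr p"
        by simp
    qed
  qed simp_all
  then have "(\<lambda>n. (\<integral>x. \<bar>s n x - u x\<bar> powr p \<partial>M) powr (1 / p)) \<longlonglongrightarrow> 0 powr (1 / p)"
    using p by (intro tendsto_powr') (auto intro: always_eventually)
  then show ?thesis
    by (simp add: Lp_seminorm_def)
qed

lemma Lp_fun_bounded:
  assumes "finite_measure M" "0 \<le> p" "u \<in> borel_measurable M" "\<And>x. x \<in> space M \<Longrightarrow> \<bar>u x\<bar> \<le> c"
  shows "u \<in> Lp_fun M p"
proof (rule Lp_fun_dominated)
  show "(\<lambda>x. c) \<in> Lp_fun M p"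
    using finite_measure.integrable_const[OF assms(1)] by (simp add: Lp_fun_def)
qed (use assms in fastforce)+

lemma indicator_in_Lp_fun:
  "finite_measure M \<Longrightarrow> 0 \<le> p \<Longrightarrow> A \<in> sets M \<Longrightarrow> (indicator A :: _ \<Rightarrow> real) \<in> Lp_fun M p"
  by (rule Lp_fun_bounded[where c=1]) (auto simp: indicator_def)

lemma sum_mem_if_closed_under_add:
  fixes D :: "('x \<Rightarrow> real) set"
  assumes "(\<lambda>x. 0) \<in> D" "\<And>u v. u \<in> D \<Longrightarrow> v \<in> D \<Longrightarrow> (\<lambda>x. u x + v x) \<in> D"
    and "finite I" "\<And>i. i \<in> I \<Longrightarrow> s i \<in> D"
  shows "(\<lambda>x. \<Sum>i\<in>I. s i x) \<in> D"
  using assms(3,4)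
proof (induction I rule: finite_induct)
  case empty
  then show ?case
    using assms(1) by simp
next
  case (insert i I)
  then have "(\<lambda>x. s i x + (\<Sum>i\<in>I. s i x)) \<in> D"
    by (intro assms(2)) auto
  then show ?case
    using insert.hyps by simp
qed

text \<open>
  A closed subspace of \<open>L\<^sup>p\<close> that contains the indicators of a generating \<open>\<pi>\<close>-system is the whole
  space. The sets whose indicators belong to it form a Dynkin system, by dominated convergence for
  disjoint unions; simple functions are linear combinations of indicators; and every function in
  \<open>L\<^sup>p\<close> is a dominated limit of simple functions.
\<close>
lemma closed_subspace_Lp_fun_all:
  fixes D :: "('x \<Rightarrow> real) set"
  assumes fin: "finite_measure M" and p: "1 \<le> p"
    and gen: "sets M = sigma_sets (space M) G" and stable: "Int_stable G" and "G \<subseteq> Pow (space M)"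
    and top: "indicator (space M) \<in> D"
    and base: "\<And>A. A \<in> G \<Longrightarrow> indicator A \<in> D"
    and add: "\<And>u v. u \<in> D \<Longrightarrow> v \<in> D \<Longrightarrow> (\<lambda>x. u x + v x) \<in> D"
    and cmult: "\<And>c u. u \<in> D \<Longrightarrow> (\<lambda>x. c * u x) \<in> D"
    and lim: "\<And>s u. \<lbrakk>\<And>n. s n \<in> D; u \<in> Lp_fun M p; (\<lambda>n. Lp_seminorm M p (\<lambda>x. s n x - u x)) \<longlonglongrightarrow> 0\<rbrakk> \<Longrightarrow> u \<in> D"
    and u: "u \<in> Lp_fun M p"
  shows "u \<in> D"
proof -
  have zero: "(\<lambda>x. 0) \<in> D"
    using cmult[OF top, of 0] by simp
  have cong: "v \<in> D" if "w \<in> D" "v \<in> Lp_fun M p" "\<And>x. x \<in> space M \<Longrightarrow> w x = v x" for v w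
  proof (rule lim[of "\<lambda>_. w"])
    have "Lp_seminorm M p (\<lambda>x. w x - v x) = Lp_seminorm M p (\<lambda>x. 0)"
      using that by (intro Lp_seminorm_cong) auto
    then show "(\<lambda>n. Lp_seminorm M p (\<lambda>x. w x - v x)) \<longlonglongrightarrow> 0"
      by (simp add: Lp_seminorm_def)
  qed (use that in auto)
  note sum = sum_mem_if_closed_under_add[of D, OF zero add]
  have dominated: "v \<in> D"
    if s: "\<And>n. s n \<in> D" "\<And>n. s n \<in> borel_measurable M" and w: "w \<in> Lp_fun M p"
      and v: "v \<in> borel_measurable M"
      and sv: "\<And>x. x \<in> space M \<Longrightarrow> (\<lambda>n. s n x) \<longlonglongrightarrow> v x"
      and le: "\<And>n x. x \<in> space M \<Longrightarrow> \<bar>s n x\<bar> \<le> \<bar>w x\<bar>" for s v w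
  proof (rule lim[OF s(1)])
    have "\<bar>v x\<bar> \<le> \<bar>w x\<bar>" if "x \<in> space M" for x
      by (rule LIMSEQ_le_const2[OF tendsto_rabs[OF sv[OF that]]]) (use le[OF that] in auto)
    then show "v \<in> Lp_fun M p"
      using p v by (intro Lp_fun_dominated[OF _ w]) auto
    show "(\<lambda>n. Lp_seminorm M p (\<lambda>x. s n x - v x)) \<longlonglongrightarrow> 0"
      using p by (intro Lp_seminorm_dominated_convergence[OF _ w v s(2) sv le]) auto
  qed
  have ind: "indicator A \<in> D" if "A \<in> sigma_sets (space M) G" for A
    using stable \<open>G \<subseteq> Pow (space M)\<close> that
  proof (induction A rule: sigma_sets_induct_disjoint)
    case (basic A)
    then show ?case
      by (rule base)
  next
    case empty
    then show ?case
      using zero by (simp add: indicator_def)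
  next
    case (compl A)
    then have "space M - A \<in> sets M"
      using gen by auto
    then have Lp: "(indicator (space M - A) :: _ \<Rightarrow> real) \<in> Lp_fun M p"
      using p fin by (intro indicator_in_Lp_fun) auto
    have "(\<lambda>x. indicator (space M) x + (-1) * indicator A x :: real) \<in> D"
      using compl by (intro add cmult top)
    then show ?case
      by (rule cong[OF _ Lp]) (auto simp: indicator_def)
  next
    case (union A)
    then have A [measurable]: "\<And>i. A i \<in> sets M"
      using gen by auto
    have partial: "(\<Sum>i<n. indicator (A i) x :: real) = indicator (\<Union>i<n. A i) x" for n x
      using union(1) by (intro indicator_UN_disjoint[symmetric]) (auto simp: disjoint_family_on_def)
    show ?case
    proof (rule dominated[where s = "\<lambda>n x. \<Sum>i<n. indicator (A i) x" and w = "\<lambda>x. 1"])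
      show "(\<lambda>x. \<Sum>i<n. indicator (A i) x :: real) \<in> D" for n
        using union by (intro sum) auto
      show "(\<lambda>x. 1) \<in> Lp_fun M p"
        using fin p by (intro Lp_fun_bounded[where c=1]) auto
      show "(\<lambda>n. \<Sum>i<n. indicator (A i) x :: real) \<longlonglongrightarrow> indicator (\<Union>i. A i) x" for x
        unfolding partial by (rule LIMSEQ_indicator_UN)
      show "\<bar>\<Sum>i<n. indicator (A i) x :: real\<bar> \<le> \<bar>1\<bar>" for n x
        unfolding partial by (simp add: indicator_def)
    qed auto
  qed
  have simple: "f \<in> D" if f: "simple_function M f" and f_Lp: "f \<in> Lp_fun M p" for f
  proof (rule cong[OF _ f_Lp])
    have fin_im: "finite (f ` space M)"
      using f by (simp add: simple_function_def)
    have "f -` {y} \<inter> space M \<in> sets M" if "y \<in> f ` space M" for y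
      using f that unfolding simple_function_def by blast
    then show "(\<lambda>x. \<Sum>y\<in>f ` space M. y * indicator (f -` {y} \<inter> space M) x) \<in> D"
      using fin_im gen by (intro sum cmult ind) auto
    show "(\<Sum>y\<in>f ` space M. y * indicator (f -` {y} \<inter> space M) x) = f x" if "x \<in> space M" for x
    proof -
      have "(\<Sum>y\<in>f ` space M. y * indicator (f -` {y} \<inter> space M) x)
          = (\<Sum>y\<in>f ` space M. if y = f x then y else 0)"
        using that by (intro sum.cong) (auto simp: indicator_def)
      then show ?thesis
        using that fin_im by simp
    qed
  qed
  have u_meas: "u \<in> borel_measurable M"
    using u by (rule Lp_funD)
  have "\<exists>s. (\<forall>i. simple_function M (s i)) \<and> (\<forall>x\<in>space M. (\<lambda>i. s i x) \<longlonglongrightarrow> u x) \<and>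
      (\<forall>i. \<forall>x\<in>space M. \<bar>s i x\<bar> \<le> 2 * \<bar>u x\<bar>)"
    using borel_measurable_implies_sequence_metric[OF u_meas, of 0] by (simp add: dist_real_def)
  then obtain s where s: "\<And>i. simple_function M (s i)" "\<And>x. x \<in> space M \<Longrightarrow> (\<lambda>i. s i x) \<longlonglongrightarrow> u x"
    "\<And>i x. x \<in> space M \<Longrightarrow> \<bar>s i x\<bar> \<le> 2 * \<bar>u x\<bar>"
    by blast
  have s_meas: "s i \<in> borel_measurable M" for i
    using s(1) by (rule borel_measurable_simple_function)
  have w: "(\<lambda>x. 2 * u x) \<in> Lp_fun M p"
    using u by (rule Lp_fun_cmult)
  have s_le: "\<bar>s i x\<bar> \<le> \<bar>2 * u x\<bar>" if "x \<in> space M" for i x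
    using s(3)[OF that] by (simp add: abs_mult)
  have s_Lp: "s i \<in> Lp_fun M p" for i
    using p s_meas s_le by (intro Lp_fun_dominated[OF _ w]) auto
  show ?thesis
    by (rule dominated[OF simple[OF s(1) s_Lp] s_meas w u_meas s(2) s_le])
qed

text \<open>
  The functions that can be approximated by pull-backs form a closed subspace: two approximations
  from different indices can be moved to a common larger index and added there. The preimages of
  measurable sets under the maps of the cone are stable under intersection for the same reason.
\<close>
lemma pullbacks_dense_in_Lp:
  assumes diag: "prob_diagram I M \<pi>" and cone: "prob_cone I M \<pi> L \<phi>" and "I \<noteq> {}"
    and directed: "\<And>R F. R \<in> I \<Longrightarrow> F \<in> I \<Longrightarrow> \<exists>T\<in>I. R \<le> T \<and> F \<le> T"
    and gen: "sets L = sigma_sets (space L) {\<phi> R -` A \<inter> space L | R A. R \<in> I \<and> A \<in> sets (M R)}"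
    and p: "1 \<le> p" and u: "u \<in> Lp_fun L p" and e: "0 < e"
  shows "\<exists>R\<in>I. \<exists>v\<in>Lp_fun (M R) p. Lp_seminorm L p (\<lambda>x. u x - v (\<phi> R x)) < e"
proof -
  have p0: "0 \<le> p"
    using p by simp
  interpret L: prob_space L
    using cone by (simp add: prob_cone_def)
  have phi: "mpres L (M R) (\<phi> R)" "\<phi> R \<in> measurable L (M R)" if "R \<in> I" for R
    using cone that by (auto simp: prob_cone_def mpres_def)
  have pi: "mpres (M F) (M R) (\<pi> R F)" if "R \<in> I" "F \<in> I" "R \<le> F" for R F
    using diag that by (simp add: prob_diagram_def)
  have compat: "\<phi> R x = \<pi> R F (\<phi> F x)" if "R \<in> I" "F \<in> I" "R \<le> F" "x \<in> space L" for R F x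
    using cone that unfolding prob_cone_def by blast
  have prob: "finite_measure (M R)" if "R \<in> I" for R
    using diag that by (auto simp: prob_diagram_def prob_space_def)
  let ?G = "{\<phi> R -` A \<inter> space L | R A. R \<in> I \<and> A \<in> sets (M R)}"
  define approx where "approx u v e R \<longleftrightarrow> R \<in> I \<and> v \<in> Lp_fun (M R) p \<and>
      Lp_seminorm L p (\<lambda>x. u x - v (\<phi> R x)) < e" for u v e R
  have lift: "approx u (v \<circ> \<pi> R T) e T" if a: "approx u v e R" and T: "T \<in> I" "R \<le> T" for u v e R T
  proof -
    from a have R: "R \<in> I" "v \<in> Lp_fun (M R) p" "Lp_seminorm L p (\<lambda>x. u x - v (\<phi> R x)) < e"
      by (auto simp: approx_def)
    have "Lp_seminorm L p (\<lambda>x. u x - (v \<circ> \<pi> R T) (\<phi> T x)) = Lp_seminorm L p (\<lambda>x. u x - v (\<phi> R x))"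
      using compat[OF R(1) T] by (intro Lp_seminorm_cong) simp
    then show ?thesis
      using R T Lp_fun_comp[OF pi[OF R(1) T] R(2)] by (simp add: approx_def)
  qed
  have exact: "approx (\<lambda>x. v (\<phi> R x)) v e R" if "R \<in> I" "v \<in> Lp_fun (M R) p" "0 < e" for v e R
    using that by (simp add: approx_def Lp_seminorm_def)
  have cyl_Lp: "(\<lambda>x. v (\<phi> R x)) \<in> Lp_fun L p" if "R \<in> I" "v \<in> Lp_fun (M R) p" for R v
    using Lp_fun_comp[OF phi(1)[OF that(1)] that(2)] by (simp add: comp_def)
  define D where "D = {u \<in> Lp_fun L p. \<forall>e>0. \<exists>R v. approx u v e R}"
  have "u \<in> D"
    using L.finite_measure_axioms p gen
  proof (rule closed_subspace_Lp_fun_all)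
    show "Int_stable ?G"
    proof (rule Int_stableI)
      fix a b assume "a \<in> ?G" "b \<in> ?G"
      then obtain R A F B where a: "a = \<phi> R -` A \<inter> space L" "R \<in> I" "A \<in> sets (M R)"
        and b: "b = \<phi> F -` B \<inter> space L" "F \<in> I" "B \<in> sets (M F)"
        by blast
      obtain T where T: "T \<in> I" "R \<le> T" "F \<le> T"
        using directed[OF a(2) b(2)] by blast
      let ?C = "(\<pi> R T -` A \<inter> space (M T)) \<inter> (\<pi> F T -` B \<inter> space (M T))"
      have "?C \<in> sets (M T)"
        using pi[OF a(2) T(1,2)] pi[OF b(2) T(1,3)] a(3) b(3)
        by (intro sets.Int measurable_sets) (auto simp: mpres_def)
      moreover have "a \<inter> b = \<phi> T -` ?C \<inter> space L"
        using measurable_space[OF phi(2)[OF T(1)]] compat[OF a(2) T(1,2)] compat[OF b(2) T(1,3)]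
        unfolding a(1) b(1) by auto
      ultimately show "a \<inter> b \<in> ?G"
        using T(1) by blast
    qed
  next
    have cyl: "indicator (\<phi> R -` A \<inter> space L) \<in> D" if R: "R \<in> I" "A \<in> sets (M R)" for R A
    proof -
      have "approx (indicator (\<phi> R -` A \<inter> space L)) (indicator A) e R" if "0 < e" for e
      proof -
        have "Lp_seminorm L p (\<lambda>x. indicator (\<phi> R -` A \<inter> space L) x - indicator A (\<phi> R x))
            = Lp_seminorm L p (\<lambda>x. 0)"
          by (intro Lp_seminorm_cong) (auto simp: indicator_def)
        then show ?thesis
          using that R prob[OF R(1)] p0
          by (auto simp: approx_def Lp_seminorm_def intro: indicator_in_Lp_fun)
      qed
      moreover have "(indicator (\<phi> R -` A \<inter> space L) :: _ \<Rightarrow> real) \<in> Lp_fun L p"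
        using L.finite_measure_axioms p0 phi(2)[OF R(1)] R(2)
        by (intro indicator_in_Lp_fun measurable_sets)
      ultimately show ?thesis
        unfolding D_def by blast
    qed
    then show "\<And>A. A \<in> ?G \<Longrightarrow> indicator A \<in> D"
      by auto
    obtain R where R: "R \<in> I"
      using \<open>I \<noteq> {}\<close> by auto
    then have "\<phi> R -` space (M R) \<inter> space L = space L"
      using measurable_space[OF phi(2)] by auto
    then show "indicator (space L) \<in> D"
      using cyl[OF R, of "space (M R)"] by simp
  next
    fix u v assume u: "u \<in> D" and v: "v \<in> D"
    have "\<exists>T w. approx (\<lambda>x. u x + v x) w e T" if "0 < e" for e
    proof -
      obtain R u' F v' where "approx u u' (e / 2) R" "approx v v' (e / 2) F"
        using u v \<open>0 < e\<close> by (auto simp: D_def dest!: spec[of _ "e / 2"])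
      moreover then obtain T where "T \<in> I" "R \<le> T" "F \<le> T"
        using directed unfolding approx_def by blast
      ultimately obtain u'' v'' where *: "approx u u'' (e / 2) T" "approx v v'' (e / 2) T"
        using lift by blast
      then have T: "T \<in> I" "u'' \<in> Lp_fun (M T) p" "v'' \<in> Lp_fun (M T) p"
        by (auto simp: approx_def)
      have "Lp_seminorm L p (\<lambda>x. (u x + v x) - (u'' (\<phi> T x) + v'' (\<phi> T x)))
          = Lp_seminorm L p (\<lambda>x. (u x - u'' (\<phi> T x)) + (v x - v'' (\<phi> T x)))"
        by (simp add: algebra_simps)
      also have "\<dots> \<le> Lp_seminorm L p (\<lambda>x. u x - u'' (\<phi> T x)) + Lp_seminorm L p (\<lambda>x. v x - v'' (\<phi> T x))"
        using u v cyl_Lp T p0 by (intro Lp_seminorm_triangle[OF p] Lp_fun_diff) (auto simp: D_def)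
      also have "\<dots> < e"
        using * by (simp add: approx_def)
      finally have "approx (\<lambda>x. u x + v x) (\<lambda>y. u'' y + v'' y) e T"
        using T p0 by (simp add: approx_def Lp_fun_add)
      then show ?thesis
        by blast
    qed
    then show "(\<lambda>x. u x + v x) \<in> D"
      using u v p0 by (simp add: D_def Lp_fun_add)
  next
    fix c u assume u: "u \<in> D"
    have "\<exists>R w. approx (\<lambda>x. c * u x) w e R" if "0 < e" for e
    proof -
      define d where "d = e / (\<bar>c\<bar> + 1)"
      have d: "0 < d" "\<bar>c\<bar> * d < e"
        using \<open>0 < e\<close> by (auto simp: d_def field_simps)
      then obtain R v where v: "approx u v d R"
        using u by (auto simp: D_def)
      have "Lp_seminorm L p (\<lambda>x. c * u x - c * v (\<phi> R x)) = \<bar>c\<bar> * Lp_seminorm L p (\<lambda>x. u x - v (\<phi> R x))"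
        using p Lp_seminorm_cmult[of p L c "\<lambda>x. u x - v (\<phi> R x)"] by (simp add: right_diff_distrib)
      also have "\<dots> \<le> \<bar>c\<bar> * d"
        using v by (intro mult_left_mono) (auto simp: approx_def)
      also have "\<dots> < e"
        by fact
      finally have "approx (\<lambda>x. c * u x) (\<lambda>y. c * v y) e R"
        using v by (simp add: approx_def Lp_fun_cmult)
      then show ?thesis
        by blast
    qed
    then show "(\<lambda>x. c * u x) \<in> D"
      using u by (simp add: D_def Lp_fun_cmult)
  next
    fix s u assume s: "\<And>n. s n \<in> D" and u: "u \<in> Lp_fun L p"
      and lim: "(\<lambda>n. Lp_seminorm L p (\<lambda>x. s n x - u x)) \<longlonglongrightarrow> 0"
    have "\<exists>R v. approx u v e R" if "0 < e" for e
    proof -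
      obtain n where n: "Lp_seminorm L p (\<lambda>x. s n x - u x) < e / 2"
        using order_tendstoD(2)[OF lim, of "e / 2"] \<open>0 < e\<close> by (auto simp: eventually_sequentially)
      obtain R v where v: "approx (s n) v (e / 2) R"
        using s[of n] \<open>0 < e\<close> by (auto simp: D_def dest!: spec[of _ "e / 2"])
      then have R: "R \<in> I" "v \<in> Lp_fun (M R) p"
        by (auto simp: approx_def)
      have "Lp_seminorm L p (\<lambda>x. u x - v (\<phi> R x))
          \<le> Lp_seminorm L p (\<lambda>x. u x - s n x) + Lp_seminorm L p (\<lambda>x. s n x - v (\<phi> R x))"
        using u s[of n] cyl_Lp[OF R] by (intro Lp_seminorm_diff_triangle[OF p]) (auto simp: D_def)
      also have "\<dots> < e"
        using n v Lp_seminorm_diff_commute[of L p u "s n"] by (simp add: approx_def)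
      finally show ?thesis
        using R unfolding approx_def by blast
    qed
    then show "u \<in> D"
      using u by (simp add: D_def)
  qed (use u in auto)
  then obtain R v where "approx u v e R"
    using e by (auto simp: D_def)
  then show ?thesis
    unfolding approx_def by blast
qed

lemma Lp_pull_pull:
  assumes f: "mpres M N f" and g: "mpres N K g" and h: "mpres M K h"
    and fg: "\<And>x. x \<in> space M \<Longrightarrow> h x = g (f x)" and z: "z \<in> vecs (Lp K p)"
  shows "Lp_pull M p h z = Lp_pull M p f (Lp_pull N p g z)"
proof -
  obtain u where u: "u \<in> Lp_fun K p" "z = Lp_class K p u"
    using z by (auto simp: vecs_Lp)
  then show ?thesis
    using fg Lp_fun_comp[OF g u(1)] Lp_fun_comp[OF h u(1)] Lp_fun_comp[OF f Lp_fun_comp[OF g u(1)]]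
    by (simp add: Lp_pull_class[OF h] Lp_pull_class[OF f] Lp_pull_class[OF g] Lp_class_eq_iff)
qed


section \<open>The colimit of the spaces \<open>L\<^sup>p\<close>\<close>

lemma ban_codiagram_Lp:
  assumes diag: "prob_diagram I M \<pi>" and p: "1 \<le> p"
  shows "ban_codiagram I (\<lambda>R. Lp (M R) p) (\<lambda>R F. Lp_pull (M F) p (\<pi> R F))"
proof -
  have pi: "mpres (M F) (M R) (\<pi> R F)" if "R \<in> I" "F \<in> I" "R \<le> F" for R F
    using diag that by (simp add: prob_diagram_def)
  have comp: "\<pi> R T x = \<pi> R F (\<pi> F T x)"
    if "R \<in> I" "F \<in> I" "T \<in> I" "R \<le> F" "F \<le> T" "x \<in> space (M T)" for R F T x
    using diag that unfolding prob_diagram_def by blast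
  have ident: "\<pi> R R x = x" if "R \<in> I" "x \<in> space (M R)" for R x
    using diag that by (simp add: prob_diagram_def)
  show ?thesis
    unfolding ban_codiagram_def
  proof (intro conjI ballI impI)
    fix R assume R: "R \<in> I"
    show "real_banach (Lp (M R) p)"
      using p by (rule real_banach_Lp)
    show "Lp_pull (M R) p (\<pi> R R) z = z" if "z \<in> vecs (Lp (M R) p)" for z
    proof -
      obtain u where u: "u \<in> Lp_fun (M R) p" "z = Lp_class (M R) p u"
        using \<open>z \<in> vecs (Lp (M R) p)\<close> by (auto simp: vecs_Lp)
      then show ?thesis
        using pi[OF R R] ident[OF R] Lp_fun_comp[OF pi[OF R R] u(1)]
        by (simp add: Lp_pull_class Lp_class_eq_iff)
    qed
    fix F assume F: "F \<in> I" "R \<le> F"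
    show "lin_isometry (Lp (M R) p) (Lp (M F) p) (Lp_pull (M F) p (\<pi> R F))"
      using p by (intro lin_isometry_Lp_pull pi R F) simp
    fix T z assume T: "T \<in> I" "F \<le> T" and z: "z \<in> vecs (Lp (M R) p)"
    have RT: "R \<le> T"
      using F(2) T(2) by (rule order_trans)
    show "Lp_pull (M T) p (\<pi> R T) z = Lp_pull (M T) p (\<pi> F T) (Lp_pull (M F) p (\<pi> R F) z)"
      by (rule Lp_pull_pull[OF pi[OF F(1) T] pi[OF R F] pi[OF R T(1) RT] comp[OF R F(1) T(1) F(2) T(2)] z])
  qed
qed

lemma ban_colimit_Lp:
  assumes diag: "prob_diagram I M \<pi>" and cone: "prob_cone I M \<pi> L \<phi>" and "I \<noteq> {}"
    and directed: "\<And>R F. R \<in> I \<Longrightarrow> F \<in> I \<Longrightarrow> \<exists>T\<in>I. R \<le> T \<and> F \<le> T"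
    and gen: "sets L = sigma_sets (space L) {\<phi> R -` A \<inter> space L | R A. R \<in> I \<and> A \<in> sets (M R)}"
    and p: "1 \<le> p"
  shows "ban_colimit TYPE('c) I (\<lambda>R. Lp (M R) p) (\<lambda>R F. Lp_pull (M F) p (\<pi> R F))
    (Lp L p) (\<lambda>R. Lp_pull L p (\<phi> R))"
proof (rule ban_colimit_of_dense_union[OF ban_codiagram_Lp[OF diag p] _ directed])
  have phi: "mpres L (M R) (\<phi> R)" if "R \<in> I" for R
    using cone that by (simp add: prob_cone_def)
  have pi: "mpres (M F) (M R) (\<pi> R F)" if "R \<in> I" "F \<in> I" "R \<le> F" for R F
    using diag that by (simp add: prob_diagram_def)
  have compat: "\<phi> R x = \<pi> R F (\<phi> F x)" if "R \<in> I" "F \<in> I" "R \<le> F" "x \<in> space L" for R F x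
    using cone that unfolding prob_cone_def by blast
  show "ban_cocone I (\<lambda>R. Lp (M R) p) (\<lambda>R F. Lp_pull (M F) p (\<pi> R F)) (Lp L p) (\<lambda>R. Lp_pull L p (\<phi> R))"
    unfolding ban_cocone_def
  proof (intro conjI ballI impI)
    show "real_banach (Lp L p)"
      using p by (rule real_banach_Lp)
    fix R assume R: "R \<in> I"
    show "lin_isometry (Lp (M R) p) (Lp L p) (Lp_pull L p (\<phi> R))"
      using p by (intro lin_isometry_Lp_pull phi R) simp
    fix F z assume F: "F \<in> I" "R \<le> F" and z: "z \<in> vecs (Lp (M R) p)"
    show "Lp_pull L p (\<phi> R) z = Lp_pull L p (\<phi> F) (Lp_pull (M F) p (\<pi> R F) z)"
      by (rule Lp_pull_pull[OF phi[OF F(1)] pi[OF R F] phi[OF R] compat[OF R F] z])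
  qed
  fix y and e :: real assume "y \<in> vecs (Lp L p)" "0 < e"
  then obtain u where u: "u \<in> Lp_fun L p" "y = Lp_class L p u"
    by (auto simp: vecs_Lp)
  obtain R v where R: "R \<in> I" and v: "v \<in> Lp_fun (M R) p"
    and close: "Lp_seminorm L p (\<lambda>x. u x - v (\<phi> R x)) < e"
    using pullbacks_dense_in_Lp[OF diag cone \<open>I \<noteq> {}\<close> directed gen p u(1) \<open>0 < e\<close>] by blast
  have "vdist (Lp L p) y (Lp_pull L p (\<phi> R) (Lp_class (M R) p v)) < e"
    using close p u Lp_fun_comp[OF phi[OF R] v] by (simp add: Lp_pull_class[OF phi[OF R] v] vdist_Lp)
  then show "\<exists>R\<in>I. \<exists>z\<in>vecs (Lp (M R) p). vdist (Lp L p) y (Lp_pull L p (\<phi> R) z) < e"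
    using R Lp_class_in_vecs[OF v] by blast
qed

text \<open>Evaluation at \<open>\<xi>\<close> factors through the restriction to the line spanned by \<open>\<xi>\<close>.\<close>
lemma sets_eval_algebra_cylinders:
  assumes M: "\<And>R. R \<in> fin_subspaces \<Longrightarrow> sets (M R) = sets (eval_algebra R)"
  shows "sets (eval_algebra UNIV) = sigma_sets (alg_dual UNIV)
    {(\<lambda>l. restrict l R) -` A \<inter> alg_dual UNIV | R A. R \<in> fin_subspaces \<and> A \<in> sets (M R)}"
    (is "_ = sigma_sets ?E ?G")
proof (intro equalityI)
  have "(\<lambda>l. l \<xi>) -` B \<inter> ?E \<in> ?G" if B: "B \<in> sets borel" for \<xi> :: 'a and B
  proof -
    let ?R = "span {\<xi>}"
    have R: "?R \<in> fin_subspaces" "\<xi> \<in> ?R"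
      by (auto intro: span_in_fin_subspaces span_base)
    then have "(\<lambda>l. l \<xi>) -` B \<inter> alg_dual ?R \<in> sets (M ?R)"
      using measurable_sets[OF measurable_eval B, of \<xi> ?R] M by (simp add: space_eval_algebra)
    moreover have "(\<lambda>l. l \<xi>) -` B \<inter> ?E = (\<lambda>l. restrict l ?R) -` ((\<lambda>l. l \<xi>) -` B \<inter> alg_dual ?R) \<inter> ?E"
      using R restrict_alg_dual[of _ UNIV ?R] by auto
    ultimately show ?thesis
      using R(1) by blast
  qed
  then show "sets (eval_algebra UNIV) \<subseteq> sigma_sets ?E ?G"
    unfolding sets_eval_algebra[of UNIV] by (intro sigma_sets_mono') blast
  have "(\<lambda>l. restrict l R) -` A \<inter> ?E \<in> sets (eval_algebra UNIV)"
    if "R \<in> fin_subspaces" "A \<in> sets (M R)" for R and A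
    using measurable_sets[OF measurable_restrict_eval_algebra[OF fin_subspaces_subspace[OF that(1)] subset_UNIV]]
      that M by (simp add: space_eval_algebra)
  then have "?G \<subseteq> sets (eval_algebra UNIV)"
    by blast
  from sets.sigma_sets_subset[OF this] show "sigma_sets ?E ?G \<subseteq> sets (eval_algebra UNIV)"
    by (simp add: space_eval_algebra)
qed

theorem theorem4p1:
  fixes chi :: "'a::real_vector \<Rightarrow> complex"
    and \<mu> :: "('a \<Rightarrow> real) measure"
    and \<mu>R :: "'a set \<Rightarrow> ('a \<Rightarrow> real) measure"
  assumes "characteristic_function chi"
    and "chi 0 = 1"
    and "corresponding_measure dual_algebra UNIV chi \<mu>"
    and "\<And>R. R \<in> fin_subspaces \<Longrightarrow> corresponding_measure (borel_dual R) R chi (\<mu>R R)"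
  shows "prob_diagram fin_subspaces \<mu>R (\<lambda>R F l. restrict l R) \<and>
    convergent_diagram fin_subspaces \<mu>R (\<lambda>R F l. restrict l R) \<and>
    prob_limit TYPE('b) fin_subspaces \<mu>R (\<lambda>R F l. restrict l R) \<mu> (\<lambda>R l. restrict l R) \<and>
    (\<forall>p::real. 1 \<le> p \<longrightarrow>
       ban_codiagram fin_subspaces (\<lambda>R. Lp (\<mu>R R) p)
         (\<lambda>R F. Lp_pull (\<mu>R F) p (\<lambda>l. restrict l R)) \<and>
       ban_colimit TYPE('c) fin_subspaces (\<lambda>R. Lp (\<mu>R R) p)
         (\<lambda>R F. Lp_pull (\<mu>R F) p (\<lambda>l. restrict l R))
         (Lp \<mu> p) (\<lambda>R. Lp_pull \<mu> p (\<lambda>l. restrict l R)))"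
proof -
  have \<mu>: "corresponding_measure (eval_algebra UNIV) UNIV chi \<mu>"
    using assms(3) by (simp add: dual_algebra_eq_eval_algebra)
  have \<mu>R: "corresponding_measure (eval_algebra R) R chi (\<mu>R R)" if "R \<in> fin_subspaces" for R
    using assms(4)[OF that] corresponding_measure_cong_sets[OF sets_borel_dual_eq_eval_algebra[OF that]]
    by simp
  have diag: "prob_diagram fin_subspaces \<mu>R (\<lambda>R F l. restrict l R)"
    by (rule prob_diagram_finite_dim_marginals[OF assms(2) \<mu>R])
  have cone: "prob_cone fin_subspaces \<mu>R (\<lambda>R F l. restrict l R) \<mu> (\<lambda>R l. restrict l R)"
    by (rule prob_cone_dual[OF assms(2) \<mu> \<mu>R])
  have "sets (\<mu>R R) = sets (eval_algebra R)" if "R \<in> fin_subspaces" for R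
    using \<mu>R[OF that] by (simp add: corresponding_measure_def)
  from sets_eval_algebra_cylinders[OF this]
  have gen: "sets \<mu> = sigma_sets (space \<mu>)
      {(\<lambda>l. restrict l R) -` A \<inter> space \<mu> | R A. R \<in> fin_subspaces \<and> A \<in> sets (\<mu>R R)}"
    using \<mu> corresponding_measure_space[OF \<mu>] by (simp add: corresponding_measure_def)
  have nonempty: "(fin_subspaces :: 'a set set) \<noteq> {}"
    using span_in_fin_subspaces[of "{}"] by auto
  show ?thesis
    using diag prob_cone_imp_convergent_diagram[OF cone] prob_limit_dual[OF assms(2) \<mu> \<mu>R]
      ban_codiagram_Lp[OF diag] ban_colimit_Lp[OF diag cone nonempty fin_subspaces_directed gen]
    by blast
qed

end
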